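(* In the bounded-domain setup assume (E1) and $$\Delta_4:=\sup_D\big(|V(x,t)|+|\nabla V(x,t)|\big)+\sup_{\Gamma\times[0,\infty)}|g(x,t)|<\infty.$$ Then there is $C>0$ independent of $\sigma_0,g,V$ such that any solution $\sigma\in C(\overline D)\cap C^{2,1}_{x,t}(D)$ of the IBVP (Σ) satisfies $\sup_{x\in U}|\sigma(x,t)|\le C\big[e^{-\eta_1t}\sup_U|\sigma_0|+\Delta_4\big]$ for all $t>0$, where $\eta_1=\ln(1+\eta_0)/(qR^2)$. Moreover $\limsup_{t\to\infty}\sup_{x\in U}|\sigma(x,t)|\le C\Delta_5$, where $\Delta_5=\limsup_{t\to\infty}\big[\sup_{x\in U}(|V(x,t)|+|\nabla V(x,t)|)+\sup_{x\in\Gamma}|g(x,t)|\big]$.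
   Context: Setup. Fix $n\ge2$. For $i=1,2$: $g_i(s)=a^{(i)}_0+\sum_{j=1}^{N_i}a^{(i)}_js^{\alpha^{(i)}_j}$ ($s\ge0$), $a^{(i)}_0>0$, $a^{(i)}_j\ge0$, real $0<\alpha^{(i)}_1<\dots$; $G_i(u)=g_i(|u|)u$ ($u\in\mathbb R$). $f_1,f_2\in C([0,1])\cap C^1((0,1))$, $f_1(0)=0=f_2(1)$, $f_1'>0>f_2'$ on $(0,1)$; $p_c'\in C^1((0,1))$, $p_c'>0$; $F_i=1/(p_c'f_i)$. Fix $r_0>0$, $c_1,c_2$ with $c_1^2+c_2^2>0$, $s_0\in(0,1)$, and let $\hat S$ be the $C^1$ solution of $\hat S'=G_2(c_2r^{1-n})F_2(\hat S)-G_1(c_1r^{1-n})F_1(\hat S)$, $\hat S(r_0)=s_0$, $0<\hat S<1$, on its maximal interval $[r_0,R_{\max})$. For $r_0\le|x|<R_{\max}$: $S_*(x)=\hat S(|x|)$, $u_i^*(x)=c_i|x|^{-n}x$. For $u\in\mathbb R^n$: $\mathbf G_i(u)=g_i(|u|)u$, Jacobian $\mathbf G_i'(u)=g_i(|u|)I_n+g_i'(|u|)uu^T/|u|$ ($=g_i(0)I_n$ at $u=0$). $B(x)=F_1(S_* )\mathbf G_1'(u_1^* )+F_2(S_* )\mathbf G_2'(u_2^* )$ (symmetric positive definite), $A=B^{-1}$, $b(x)=F_2'(S_* )\mathbf G_2(u_2^* )-F_1'(S_* )\mathbf G_1(u_1^* )$. $C^{2,1}_{x,t}$: continuous with continuous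 $x$-derivatives up to order 2 and $t$-derivative of order 1; $C^m_x$ similarly for $x$-derivatives up to order $m$. Bounded-domain setup: fix $R\in(r_0,R_{\max})$ with $0<\underline s\le\hat S(r)\le\bar s<1$ on $[r_0,R]$; $U$ open bounded, $U\subset B_R\setminus\overline{B_{r_0}}$, $\Gamma=\partial U$, $D=U\times(0,\infty)$. Constants: $d_0=\min\{g_1(0),g_2(0)\}$, $d_1=\sum_i g_i(|c_i|r_0^{1-n})$, $d_2=\sum_i g_i(|c_i|r_0^{1-n})|c_i|r_0^{1-n}$, $d_3=\sum_i g_i'(|c_i|r_0^{1-n})|c_i|r_0^{1-n}$ (terms with $c_i=0$ read as $0$), $d_4=d_1+d_3$; $\mu_1=\sum_i\max_{[\underline s,\bar s]}F_i$, $\mu_2=\sum_i\min_{[\underline s,\bar s]}F_i$, $\mu_3=\sum_i\max_{[\underline s,\bar s]}|F_i'|$; $C_0=d_4\mu_1$, $C_1=d_0\mu_2$, $C_2=d_2\mu_3$; $\kappa_0=C_0/(2C_1)$, $s_R=\kappa_0(n+C_2R)$, $q=\kappa_0C_0/(2s_R)$, $\eta_0=(r_0/R)^{2s_R}$. Given the total velocity $V:\overline D\to\mathbb R^n$, set $c(x,t)=F_1(S_*(x))\mathbf G_1'(u_1^*(x))V(x,t)$. IBVP (Σ): $\sigma_t=\nabla\cdot[A(\nabla\sigma-\sigma b)]+\nabla\cdot(Ac)$ in $D$, $\sigma=g$ on $\Gamma\times(0,\infty)$, $\sigma(x,0)=\sigma_0(x)$ in $U$, where $\sigma_0\in C(\overline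 U)$, $g\in C(\Gamma\times[0,\infty))$, $\sigma_0=g(\cdot,0)$ on $\Gamma$. Condition (E1): $F_1,F_2\in C^7((0,1))$, $V\in C^6_x(\overline D)$, $V_t\in C^3_x(\overline D)$ (under (E1), (Σ) has a unique classical solution). *)

theory Defs
  imports "HOL-Analysis.Analysis"
begin

text \<open>g(s) = a0 + sum_{j<N} a_j s^(al_j) for s >= 0 (indices shifted to start at 0).\<close>
definition gfun :: "real \<Rightarrow> (nat \<Rightarrow> real) \<Rightarrow> (nat \<Rightarrow> real) \<Rightarrow> nat \<Rightarrow> real \<Rightarrow> real" where
  "gfun a0 a al N s = a0 + (\<Sum>j<N. a j * s powr al j)"

definition admissible_g :: "(real \<Rightarrow> real) \<Rightarrow> bool" where
  "admissible_g g \<longleftrightarrow> (\<exists>a0 a al N. a0 > 0 \<and> (\<forall>j<N. a j \<ge> 0 \<and> al j > 0)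
      \<and> (\<forall>i j. i < j \<and> j < N \<longrightarrow> al i < al j)
      \<and> (\<forall>s\<ge>0. g s = gfun a0 a al N s))"

definition Gs :: "(real \<Rightarrow> real) \<Rightarrow> real \<Rightarrow> real" where
  "Gs g u = g \<bar>u\<bar> * u"

definition Gvec :: "(real \<Rightarrow> real) \<Rightarrow> real^'n \<Rightarrow> real^'n" where
  "Gvec g u = g (norm u) *\<^sub>R u"

definition outer :: "real^'n \<Rightarrow> real^'n \<Rightarrow> real^'n^'n" where
  "outer u w = (\<chi> i j. u $ i * w $ j)"

definition Gjac :: "(real \<Rightarrow> real) \<Rightarrow> real^'n \<Rightarrow> real^'n^'n" where
  "Gjac g u = (if u = 0 then g 0 *\<^sub>R mat 1
     else g (norm u) *\<^sub>R mat 1 + (deriv g (norm u) / norm u) *\<^sub>R outer u u)"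

text \<open>F = 1/(p_c' f)\<close>
definition Fq :: "(real \<Rightarrow> real) \<Rightarrow> (real \<Rightarrow> real) \<Rightarrow> real \<Rightarrow> real" where
  "Fq pcd f s = 1 / (pcd s * f s)"

text \<open>C^k on a set S of reals (S open).\<close>
definition Ck_on :: "nat \<Rightarrow> real set \<Rightarrow> (real \<Rightarrow> real) \<Rightarrow> bool" where
  "Ck_on k S F \<longleftrightarrow> (\<forall>j\<le>k. continuous_on S ((deriv ^^ j) F)
      \<and> (j < k \<longrightarrow> (\<forall>x\<in>S. ((deriv ^^ j) F) field_differentiable (at x))))"

definition has_pd :: "'n::finite \<Rightarrow> (real^'n \<Rightarrow> real) \<Rightarrow> real^'n \<Rightarrow> bool" where
  "has_pd i f x \<longleftrightarrow> (\<lambda>h. f (x + h *\<^sub>R axis i 1)) field_differentiable (at 0)"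

definition pd :: "'n::finite \<Rightarrow> (real^'n \<Rightarrow> real) \<Rightarrow> real^'n \<Rightarrow> real" where
  "pd i f x = deriv (\<lambda>h. f (x + h *\<^sub>R axis i 1)) 0"

fun ipd :: "'n::finite list \<Rightarrow> (real^'n \<Rightarrow> real) \<Rightarrow> real^'n \<Rightarrow> real" where
  "ipd [] f = f"
| "ipd (i # is) f = pd i (ipd is f)"

definition grad :: "(real^'n \<Rightarrow> real) \<Rightarrow> real^'n \<Rightarrow> real^'n" where
  "grad f x = (\<chi> i. pd i f x)"

definition divg :: "(real^'n \<Rightarrow> real^'n) \<Rightarrow> real^'n \<Rightarrow> real" where
  "divg W x = (\<Sum>i\<in>UNIV. pd i (\<lambda>y. W y $ i) x)"

definition Vgrad :: "(real^'n \<Rightarrow> real \<Rightarrow> real^'n) \<Rightarrow> real^'n \<Rightarrow> real \<Rightarrow> real^'n^'n" where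
  "Vgrad V x t = (\<chi> k i. pd i (\<lambda>y. V y t $ k) x)"

text \<open>C^m_x(closure D), D = U x (0,oo): continuous on closure D; all x-derivatives up to
  order m exist at points of U x [0,oo) and extend continuously to closure D.\<close>
definition Cx_closure :: "nat \<Rightarrow> (real^'n) set \<Rightarrow> (real^'n \<Rightarrow> real \<Rightarrow> real) \<Rightarrow> bool" where
  "Cx_closure m U W \<longleftrightarrow>
     continuous_on (closure U \<times> {0..}) (\<lambda>(x,t). W x t)
   \<and> (\<forall>is. length is < m \<longrightarrow> (\<forall>i. \<forall>x\<in>U. \<forall>t\<ge>0. has_pd i (ipd is (\<lambda>y. W y t)) x))
   \<and> (\<forall>is. length is \<le> m \<longrightarrow> (\<exists>h. continuous_on (closure U \<times> {0..}) h
          \<and> (\<forall>x\<in>U. \<forall>t\<ge>0. h (x,t) = ipd is (\<lambda>y. W y t) x)))"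

definition C21 :: "(real^'n) set \<Rightarrow> (real^'n \<Rightarrow> real \<Rightarrow> real) \<Rightarrow> bool" where
  "C21 U W \<longleftrightarrow>
     continuous_on (U \<times> {0<..}) (\<lambda>(x,t). W x t)
   \<and> (\<forall>is. length is < 2 \<longrightarrow> (\<forall>i. \<forall>x\<in>U. \<forall>t>0. has_pd i (ipd is (\<lambda>y. W y t)) x))
   \<and> (\<forall>is. length is \<le> 2 \<longrightarrow> continuous_on (U \<times> {0<..}) (\<lambda>(x,t). ipd is (\<lambda>y. W y t) x))
   \<and> (\<forall>x\<in>U. \<forall>t>0. (W x) field_differentiable (at t))
   \<and> continuous_on (U \<times> {0<..}) (\<lambda>(x,t). deriv (W x) t)"

definition ustar :: "real \<Rightarrow> real^'n \<Rightarrow> real^'n" where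
  "ustar c x = (c / norm x ^ CARD('n)) *\<^sub>R x"

definition Bmat :: "(real \<Rightarrow> real) \<Rightarrow> (real \<Rightarrow> real) \<Rightarrow> (real \<Rightarrow> real) \<Rightarrow> (real \<Rightarrow> real)
    \<Rightarrow> real \<Rightarrow> real \<Rightarrow> (real \<Rightarrow> real) \<Rightarrow> real^'n \<Rightarrow> real^'n^'n" where
  "Bmat F1 F2 g1 g2 c1 c2 Shat x =
     F1 (Shat (norm x)) *\<^sub>R Gjac g1 (ustar c1 x) + F2 (Shat (norm x)) *\<^sub>R Gjac g2 (ustar c2 x)"

definition Amat :: "(real \<Rightarrow> real) \<Rightarrow> (real \<Rightarrow> real) \<Rightarrow> (real \<Rightarrow> real) \<Rightarrow> (real \<Rightarrow> real)
    \<Rightarrow> real \<Rightarrow> real \<Rightarrow> (real \<Rightarrow> real) \<Rightarrow> real^'n \<Rightarrow> real^'n^'n" where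
  "Amat F1 F2 g1 g2 c1 c2 Shat x = matrix_inv (Bmat F1 F2 g1 g2 c1 c2 Shat x)"

definition bvec :: "(real \<Rightarrow> real) \<Rightarrow> (real \<Rightarrow> real) \<Rightarrow> (real \<Rightarrow> real) \<Rightarrow> (real \<Rightarrow> real)
    \<Rightarrow> real \<Rightarrow> real \<Rightarrow> (real \<Rightarrow> real) \<Rightarrow> real^'n \<Rightarrow> real^'n" where
  "bvec F1 F2 g1 g2 c1 c2 Shat x =
     deriv F2 (Shat (norm x)) *\<^sub>R Gvec g2 (ustar c2 x) - deriv F1 (Shat (norm x)) *\<^sub>R Gvec g1 (ustar c1 x)"

definition cvec :: "(real \<Rightarrow> real) \<Rightarrow> (real \<Rightarrow> real) \<Rightarrow> real \<Rightarrow> (real \<Rightarrow> real)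
    \<Rightarrow> (real^'n \<Rightarrow> real \<Rightarrow> real^'n) \<Rightarrow> real^'n \<Rightarrow> real \<Rightarrow> real^'n" where
  "cvec F1 g1 c1 Shat V x t = F1 (Shat (norm x)) *\<^sub>R (Gjac g1 (ustar c1 x) *v V x t)"

definition eta1 :: "real \<Rightarrow> real \<Rightarrow> real \<Rightarrow> (real \<Rightarrow> real) \<Rightarrow> (real \<Rightarrow> real) \<Rightarrow> real \<Rightarrow> real
    \<Rightarrow> (real \<Rightarrow> real) \<Rightarrow> (real \<Rightarrow> real) \<Rightarrow> real \<Rightarrow> real \<Rightarrow> real" where
  "eta1 n r0 R g1 g2 c1 c2 F1 F2 sl sh =
    (let z1 = \<bar>c1\<bar> * r0 powr (1 - n); z2 = \<bar>c2\<bar> * r0 powr (1 - n);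
         d0 = min (g1 0) (g2 0);
         d1 = g1 z1 + g2 z2;
         d2 = g1 z1 * z1 + g2 z2 * z2;
         d3 = (if c1 = 0 then 0 else deriv g1 z1 * z1) + (if c2 = 0 then 0 else deriv g2 z2 * z2);
         d4 = d1 + d3;
         mu1 = Sup (F1 ` {sl..sh}) + Sup (F2 ` {sl..sh});
         mu2 = Inf (F1 ` {sl..sh}) + Inf (F2 ` {sl..sh});
         mu3 = Sup ((\<lambda>s. \<bar>deriv F1 s\<bar>) ` {sl..sh}) + Sup ((\<lambda>s. \<bar>deriv F2 s\<bar>) ` {sl..sh});
         C0 = d4 * mu1; C1 = d0 * mu2; C2 = d2 * mu3;
         k0 = C0 / (2 * C1);
         sR = k0 * (n + C2 * R);
         q = k0 * C0 / (2 * sR);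
         eta0 = (r0 / R) powr (2 * sR)
     in ln (1 + eta0) / (q * R\<^sup>2))"

end

theory Submission
  imports Defs
begin

text \<open>
  All coefficients are radial: the position vector is an eigenvector of \<open>B\<close>, and \<open>b\<close> is the gradient of
  a radial function \<open>\<Lambda>\<close>. With \<open>w = e^{-\<Lambda>} \<sigma>\<close> the equation becomes
  \<open>e^\<Lambda> w_t = div (e^\<Lambda> A \<nabla>w) + div (A c)\<close>. Put \<open>k = C\<^sub>2 R\<close> and take the radial function \<open>h\<close> with
  \<open>A \<nabla>h = -|x|^k x\<close>, normalised to lie between \<open>C\<^sub>0 r\<^sub>0^{k+2} / (k+2)\<close> and \<open>C\<^sub>0 R^{k+2} / (k+2)\<close>. Since
  \<open>|b| \<le> C\<^sub>2\<close>, \<open>-e^{-\<Lambda>} div (e^\<Lambda> A \<nabla>h) \<ge> n r\<^sub>0^k\<close>, so \<open>h\<close> is a positive supersolution with the decay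
  rate \<open>n (k+2) r\<^sub>0^k / (C\<^sub>0 R^{k+2})\<close>, which is at least \<open>\<eta>\<^sub>1\<close>. The maximum principle for
  \<open>\<plusminus>w - (\<alpha> e^{-rate t} + \<gamma>) h\<close> gives the estimate; applying it from a late initial time gives the limsup bound.
\<close>

section \<open>Partial derivatives and second-order conditions\<close>

text \<open>The term -sigma div(A b) in the equation for sigma has no sign, so sigma itself obeys no
  maximum principle; the equation for w has no term of order zero. Prescribing the flux A grad h
  instead of h makes its divergence explicit without differentiating A, and h is recovered by one
  radial integration because x is an eigenvector of A. The exponent k is chosen so that the drift
  cannot cancel the dimension n in the divergence of r^k x. The number eta1 has the shape of a
  contraction by 1/(1 + eta0) over each time span q R^2; the barrier instead gives exponential decay
  at once, and the comparison of the two rates is an elementary inequality between constants. Since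
  all coefficients are bounded on the annulus, every constant is fixed before the data sigma0, g and
  V are introduced.\<close>

lemma has_derivative_pd:
  fixes f :: "real^'n \<Rightarrow> real"
  assumes "(f has_derivative D) (at x)"
  shows "((\<lambda>h. f (x + h *\<^sub>R axis i 1)) has_real_derivative D (axis i 1)) (at 0)"
    and "has_pd i f x" and "pd i f x = D (axis i 1)"
proof -
  have *: "((\<lambda>h. x + h *\<^sub>R axis i (1::real)) has_derivative (\<lambda>h. h *\<^sub>R axis i 1)) (at 0)"
    by (auto intro!: derivative_eq_intros)
  have "((\<lambda>h. f (x + h *\<^sub>R axis i 1)) has_derivative (\<lambda>h. D (h *\<^sub>R axis i 1))) (at 0)"
    by (rule has_derivative_compose[OF *]) (use assms in simp)
  moreover have "(\<lambda>h. D (h *\<^sub>R axis i 1)) = (*) (D (axis i 1))"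
    using linear_cmul[OF has_derivative_linear[OF assms]] by (auto simp: fun_eq_iff)
  ultimately show 1: "((\<lambda>h. f (x + h *\<^sub>R axis i 1)) has_real_derivative D (axis i 1)) (at 0)"
    by (simp add: has_field_derivative_def)
  then show "has_pd i f x" "pd i f x = D (axis i 1)"
    unfolding has_pd_def pd_def field_differentiable_def by (auto intro: DERIV_imp_deriv)
qed

lemma has_pd_line:
  fixes f :: "real^'n \<Rightarrow> real"
  assumes "has_pd i f (x + s *\<^sub>R axis i 1)"
  shows "((\<lambda>h. f (x + h *\<^sub>R axis i 1)) has_real_derivative pd i f (x + s *\<^sub>R axis i 1)) (at s)"
proof -
  let ?g = "\<lambda>h. f (x + s *\<^sub>R axis i 1 + h *\<^sub>R axis i 1)"
  have "(?g has_real_derivative pd i f (x + s *\<^sub>R axis i 1)) (at 0)"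
    using assms DERIV_deriv_iff_field_differentiable unfolding has_pd_def pd_def by blast
  then have "((\<lambda>h. ?g (h - s)) has_real_derivative pd i f (x + s *\<^sub>R axis i 1)) (at s)"
    using DERIV_shift[of "\<lambda>h. ?g (h - s)" "pd i f (x + s *\<^sub>R axis i 1)" 0 s] by simp
  then show ?thesis by (simp add: algebra_simps)
qed

lemma eventually_line_in_open:
  fixes x v :: "'a::real_normed_vector"
  assumes "open U" "x \<in> U"
  shows "\<forall>\<^sub>F s in nhds 0. x + s *\<^sub>R v \<in> U"
proof -
  have "isCont (\<lambda>s. x + s *\<^sub>R v) 0" by (intro continuous_intros)
  then have "((\<lambda>s. x + s *\<^sub>R v) \<longlongrightarrow> x + 0 *\<^sub>R v) (nhds 0)"
    by (metis isCont_def tendsto_at_iff_tendsto_nhds)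
  then show ?thesis using assms by (simp add: tendsto_def)
qed

lemma pd_cong_open:
  assumes "open U" "x \<in> U" "\<And>y. y \<in> U \<Longrightarrow> f y = (f' y::real)"
  shows "pd i f x = pd i f' x"
  using eventually_line_in_open[OF assms(1,2), of "axis i 1"] unfolding pd_def
    by (intro deriv_cong_ev) (auto elim: eventually_mono simp: assms(3))

text \<open>Mean value inequality for \<open>f\<close> minus a linear function of slope
  \<open>c\<close> on a coordinate segment. It is one step of the path along the axes in
  \<open>has_derivative_of_partials\<close>.\<close>

lemma mean_value_coord:
  fixes f :: "real^'n \<Rightarrow> real"
  assumes "\<And>s. \<bar>s\<bar> \<le> \<bar>h\<bar> \<Longrightarrow> has_pd i f (y + s *\<^sub>R axis i 1) \<and> \<bar>pd i f (y + s *\<^sub>R axis i 1) - c\<bar> \<le> e"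
  shows "\<bar>f (y + h *\<^sub>R axis i 1) - f y - h * c\<bar> \<le> e * \<bar>h\<bar>"
proof -
  let ?S = "closed_segment 0 h"
  have S: "s \<in> ?S \<Longrightarrow> \<bar>s\<bar> \<le> \<bar>h\<bar>" for s
    by (auto simp: closed_segment_eq_real_ivl split: if_splits)
  have "norm ((\<lambda>s. f (y + s *\<^sub>R axis i 1) - s * c) h - (\<lambda>s. f (y + s *\<^sub>R axis i 1) - s * c) 0) \<le> e * norm (h - 0)"
  proof (rule field_differentiable_bound[of ?S _ "\<lambda>s. pd i f (y + s *\<^sub>R axis i 1) - c"])
    show "((\<lambda>s. f (y + s *\<^sub>R axis i 1) - s * c) has_field_derivative pd i f (y + s *\<^sub>R axis i 1) - c) (at s within ?S)"
      if "s \<in> ?S" for s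
      using has_pd_line[of i f y s] assms[OF S[OF that]]
      by (auto intro!: derivative_eq_intros intro: has_field_derivative_at_within)
  qed (use assms S in auto)
  then show ?thesis by (simp add: algebra_simps)
qed

text \<open>\<open>C21\<close> speaks only of iterated partial derivatives, whereas testing a
  maximum along arbitrary lines requires a total derivative. The increment is split into moves
  parallel to the axes, one coordinate at a time.\<close>

lemma has_derivative_of_partials:
  fixes f :: "real^'n \<Rightarrow> real"
  assumes U: "open U" "x \<in> U" and pd: "\<And>i y. y \<in> U \<Longrightarrow> has_pd i f y"
    and cont: "\<And>i. continuous_on U (pd i f)"
  shows "(f has_derivative (\<lambda>v. \<Sum>i\<in>UNIV. v $ i * pd i f x)) (at x)"
  unfolding has_derivative_at_alt
proof (intro conjI allI impI)
  show "bounded_linear (\<lambda>v. \<Sum>i\<in>UNIV. v $ i * pd i f x)"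
    by (intro bounded_linear_sum bounded_linear_mult_const bounded_linear_vec_nth)
  fix e :: real assume e: "e > 0"
  \<comment> \<open>Each coordinate contributes an error of at most
    \<open>?e * norm (y - x)\<close>, and there are \<open>CARD('n)\<close> of them.\<close>
  let ?e = "e / CARD('n)"
  have e': "?e > 0" using e by simp
  have "\<forall>i. \<forall>\<^sub>F y in nhds x. \<bar>pd i f y - pd i f x\<bar> < ?e \<and> y \<in> U"
  proof
    fix i
    have "isCont (pd i f) x" using cont U by (simp add: continuous_on_eq_continuous_at)
    then have "(pd i f \<longlongrightarrow> pd i f x) (nhds x)" by (simp add: isCont_def tendsto_at_iff_tendsto_nhds)
    then have "\<forall>\<^sub>F y in nhds x. dist (pd i f y) (pd i f x) < ?e" using e' by (rule tendstoD)
    then show "\<forall>\<^sub>F y in nhds x. \<bar>pd i f y - pd i f x\<bar> < ?e \<and> y \<in> U"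
      using U by (auto simp: dist_real_def eventually_conj_iff eventually_nhds_in_open)
  qed
  then have "\<forall>\<^sub>F y in nhds x. \<forall>i. \<bar>pd i f y - pd i f x\<bar> < ?e \<and> y \<in> U"
    by (intro eventually_all_finite) blast
  then obtain d where d: "d > 0" "\<And>y i. dist y x < d \<Longrightarrow> \<bar>pd i f y - pd i f x\<bar> < ?e \<and> y \<in> U"
    unfolding eventually_nhds_metric by blast
  have main: "\<bar>f (x + (\<Sum>i\<in>S. v$i *\<^sub>R axis i 1)) - f x - (\<Sum>i\<in>S. v $ i * pd i f x)\<bar> \<le> ?e * (\<Sum>i\<in>S. \<bar>v$i\<bar>)"
    if v: "norm v < d" for v :: "real^'n" and S
  proof (induction S rule: infinite_finite_induct)
    case (insert i S)
    let ?y = "x + (\<Sum>i\<in>S. v$i *\<^sub>R axis i 1)"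
    have "\<bar>f (?y + v$i *\<^sub>R axis i 1) - f ?y - v$i * pd i f x\<bar> \<le> ?e * \<bar>v$i\<bar>"
    proof (rule mean_value_coord)
      fix s assume s: "\<bar>s\<bar> \<le> \<bar>v$i\<bar>"
      \<comment> \<open>The coordinates of the displacement are those of \<open>v\<close> on
        \<open>S\<close>, \<open>s\<close> in place \<open>i\<close>, and 0 elsewhere, so the path
        never leaves the ball of radius \<open>d\<close>.\<close>
      have "norm ((\<Sum>i\<in>S. v$i *\<^sub>R axis i (1::real)) + s *\<^sub>R axis i 1) \<le> norm v"
      proof (rule norm_le_componentwise_cart)
        fix j
        show "norm (((\<Sum>i\<in>S. v$i *\<^sub>R axis i (1::real)) + s *\<^sub>R axis i 1) $ j) \<le> norm (v $ j)"
          using insert.hyps s by (simp add: axis_def sum.delta if_distrib cong: if_cong)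
      qed
      then have "dist (?y + s *\<^sub>R axis i 1) x < d" using v by (simp add: dist_norm algebra_simps)
      from d(2)[OF this, of i] show "has_pd i f (?y + s *\<^sub>R axis i 1) \<and> \<bar>pd i f (?y + s *\<^sub>R axis i 1) - pd i f x\<bar> \<le> ?e"
        using pd by auto
    qed
    then show ?case using insert by (simp add: algebra_simps)
  qed auto
  show "\<exists>d>0. \<forall>y. norm (y - x) < d \<longrightarrow>
      norm (f y - f x - (\<Sum>i\<in>UNIV. (y - x) $ i * pd i f x)) \<le> e * norm (y - x)"
  proof (intro exI conjI allI impI)
    fix y assume y: "norm (y - x) < d"
    have "(\<Sum>i\<in>UNIV. (y - x)$i *\<^sub>R axis i (1::real)) = y - x"
      by (simp add: vec_eq_iff axis_def sum.delta if_distrib cong: if_cong)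
    then have "\<bar>f y - f x - (\<Sum>i\<in>UNIV. (y - x) $ i * pd i f x)\<bar> \<le> ?e * (\<Sum>i\<in>UNIV. \<bar>(y-x)$i\<bar>)"
      using main[OF y, of UNIV] by simp
    also have "\<dots> \<le> ?e * (\<Sum>i\<in>(UNIV::'n set). norm (y - x))"
      using e' by (intro mult_left_mono sum_mono component_le_norm_cart) auto
    finally show "norm (f y - f x - (\<Sum>i\<in>UNIV. (y - x) $ i * pd i f x)) \<le> e * norm (y - x)" by simp
  qed (use d in auto)
qed

section \<open>Necessary conditions at an interior maximum\<close>

lemma second_derivative_nonpos_at_max:
  fixes \<phi> :: "real \<Rightarrow> real"
  assumes d: "d > 0" "\<And>s. \<bar>s\<bar> < d \<Longrightarrow> (\<phi> has_real_derivative \<psi> s) (at s)"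
    and dd: "(\<psi> has_real_derivative c) (at 0)"
    and mx: "\<And>s. \<bar>s\<bar> < d \<Longrightarrow> \<phi> s \<le> \<phi> 0"
  shows "\<psi> 0 = 0" and "c \<le> 0"
proof -
  show 0: "\<psi> 0 = 0"
    by (rule DERIV_local_max[OF d(2) d(1)]) (use d mx in auto)
  show "c \<le> 0"
  proof (rule ccontr)
    assume "\<not> c \<le> 0"
    \<comment> \<open>If \<open>c > 0\<close>, then \<open>\<psi>\<close> is positive just to the
      right of 0, and the mean value theorem gives a value of \<open>\<phi>\<close> larger than the
      maximum.\<close>
    then obtain e where e: "e > 0" "\<And>h. h > 0 \<Longrightarrow> h < e \<Longrightarrow> \<psi> 0 < \<psi> (0 + h)"
      using DERIV_pos_inc_right[OF dd] by auto
    define s where "s = min d e / 2"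
    have s: "s > 0" "s < d" "s < e" using d e by (auto simp: s_def)
    obtain z where z: "0 < z" "z < s" "\<phi> s - \<phi> 0 = (s - 0) * \<psi> z"
      using MVT2[of 0 s \<phi> \<psi>] d(2) s by force
    have "\<psi> z > 0" using e(2)[of z] z s 0 by simp
    then have "s * \<psi> z > 0" using s by simp
    then show False using z s mx[of s] by simp
  qed
qed

text \<open>Restriction to lines through \<open>x\<close> reduces the claim to one variable. The
  gradient components \<open>G j\<close> are differentiated only at \<open>x\<close> itself, and
  \<open>D j v\<close> is the second derivative in the directions \<open>j\<close> and
  \<open>v\<close>.\<close>

lemma hessian_nonpos_at_max:
  fixes Z :: "real^'n \<Rightarrow> real" and G :: "'n \<Rightarrow> real^'n \<Rightarrow> real"
  assumes U: "open U" "x \<in> U"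
    and Z: "\<And>y. y \<in> U \<Longrightarrow> (Z has_derivative (\<lambda>v. \<Sum>j\<in>UNIV. v $ j * G j y)) (at y)"
    and G: "\<And>j. (G j has_derivative D j) (at x)"
    and mx: "\<And>y. y \<in> U \<Longrightarrow> Z y \<le> Z x"
  shows "G j x = 0" and "(\<Sum>j\<in>UNIV. v $ j * D j v) \<le> 0"
proof -
  have line: "(\<Sum>j\<in>UNIV. v $ j * G j x) = 0 \<and> (\<Sum>j\<in>UNIV. v $ j * D j v) \<le> 0" for v
  proof -
    have L: "((\<lambda>s. x + s *\<^sub>R v) has_derivative (\<lambda>h. h *\<^sub>R v)) (at s)" for s
      by (auto intro!: derivative_eq_intros)
    from eventually_line_in_open[OF U, of v] obtain d where d: "d > 0" "\<And>s. \<bar>s\<bar> < d \<Longrightarrow> x + s *\<^sub>R v \<in> U"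
      unfolding eventually_nhds_metric by (auto simp: dist_real_def)
    have 1: "((\<lambda>s. Z (x + s *\<^sub>R v)) has_real_derivative (\<Sum>j\<in>UNIV. v $ j * G j (x + s *\<^sub>R v))) (at s)"
      if "\<bar>s\<bar> < d" for s
    proof -
      have "(\<lambda>h. \<Sum>j\<in>UNIV. (h *\<^sub>R v) $ j * G j (x + s *\<^sub>R v)) = (*) (\<Sum>j\<in>UNIV. v $ j * G j (x + s *\<^sub>R v))"
        by (simp add: fun_eq_iff sum_distrib_left mult_ac)
      then show ?thesis
        using has_derivative_compose[OF L Z[OF d(2)[OF that]]] by (simp add: has_field_derivative_def)
    qed
    have 2: "((\<lambda>s. \<Sum>j\<in>UNIV. v $ j * G j (x + s *\<^sub>R v)) has_real_derivative (\<Sum>j\<in>UNIV. v $ j * D j v)) (at 0)"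
    proof (intro DERIV_sum DERIV_cmult)
      fix j
      have "((\<lambda>s. G j (x + s *\<^sub>R v)) has_derivative (\<lambda>h. D j (h *\<^sub>R v))) (at 0)"
        by (rule has_derivative_compose[OF L]) (use G in simp)
      moreover have "(\<lambda>h. D j (h *\<^sub>R v)) = (*) (D j v)"
        using linear_cmul[OF has_derivative_linear[OF G]] by (auto simp: fun_eq_iff)
      ultimately show "((\<lambda>s. G j (x + s *\<^sub>R v)) has_real_derivative D j v) (at 0)"
        by (simp add: has_field_derivative_def)
    qed
    from second_derivative_nonpos_at_max[OF d(1) 1 2] mx d show ?thesis by auto
  qed
  show "(\<Sum>j\<in>UNIV. v $ j * D j v) \<le> 0" using line by blast
  show "G j x = 0" using line[of "axis j 1"]
    by (simp add: axis_def if_distrib if_distribR sum.delta cong: if_cong)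
qed

text \<open>With the coefficient matrix written as Q^T Q, the trace of its product with the Hessian
  becomes the sum, over the rows \<open>Q $ k\<close>, of the values of the Hessian form at these
  rows.\<close>

lemma trace_hessian_nonpos:
  fixes D :: "'n::finite \<Rightarrow> real^'n \<Rightarrow> real" and Q :: "real^'n^'n"
  assumes lin: "\<And>j. linear (D j)" and neg: "\<And>v. (\<Sum>j\<in>UNIV. v $ j * D j v) \<le> 0"
  shows "(\<Sum>i\<in>UNIV. \<Sum>j\<in>UNIV. (\<Sum>k\<in>UNIV. Q $ k $ i * Q $ k $ j) * D j (axis i 1)) \<le> 0"
proof -
  have D: "D j v = (\<Sum>i\<in>UNIV. v $ i * D j (axis i 1))" for j v
  proof -
    have "v = (\<Sum>i\<in>UNIV. v$i *\<^sub>R axis i (1::real))"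
      by (simp add: vec_eq_iff axis_def sum.delta if_distrib cong: if_cong)
    then have "D j v = D j (\<Sum>i\<in>UNIV. v$i *\<^sub>R axis i (1::real))" by simp
    then show ?thesis by (simp add: linear_sum[OF lin] linear_cmul[OF lin])
  qed
  have "(\<Sum>i\<in>UNIV. \<Sum>j\<in>UNIV. (\<Sum>k\<in>UNIV. Q $ k $ i * Q $ k $ j) * D j (axis i 1))
      = (\<Sum>i\<in>UNIV. \<Sum>j\<in>UNIV. \<Sum>k\<in>UNIV. Q $ k $ i * Q $ k $ j * D j (axis i 1))"
    by (simp add: sum_distrib_right)
  also have "\<dots> = (\<Sum>i\<in>UNIV. \<Sum>k\<in>UNIV. \<Sum>j\<in>UNIV. Q $ k $ i * Q $ k $ j * D j (axis i 1))"
    by (intro sum.cong refl sum.swap)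
  also have "\<dots> = (\<Sum>k\<in>UNIV. \<Sum>i\<in>UNIV. \<Sum>j\<in>UNIV. Q $ k $ i * Q $ k $ j * D j (axis i 1))"
    by (rule sum.swap)
  also have "\<dots> = (\<Sum>k\<in>UNIV. \<Sum>j\<in>UNIV. \<Sum>i\<in>UNIV. Q $ k $ i * Q $ k $ j * D j (axis i 1))"
    by (intro sum.cong refl sum.swap)
  also have "\<dots> = (\<Sum>k\<in>UNIV. \<Sum>j\<in>UNIV. Q $ k $ j * D j (Q $ k))"
    by (subst (2) D) (simp add: sum_distrib_left mult_ac)
  also have "\<dots> \<le> 0" by (intro sum_nonpos neg)
  finally show ?thesis .
qed

section \<open>Radial functions and matrices\<close>

text \<open>The coefficients are controlled only on the closed interval \<open>{r0..R}\<close>,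
  where the ODE provides derivatives within the interval. Hence the derivative is relative to
  \<open>S\<close> and existentially quantified; at an endpoint \<open>deriv\<close> would ask about
  values outside.\<close>

definition C1_on :: "real set \<Rightarrow> (real \<Rightarrow> real) \<Rightarrow> bool" where
  "C1_on S f \<longleftrightarrow> (\<exists>f'. continuous_on S f' \<and> (\<forall>x\<in>S. (f has_real_derivative f' x) (at x within S)))"

lemma C1_onI:
  "continuous_on S f' \<Longrightarrow> (\<And>x. x \<in> S \<Longrightarrow> (f has_real_derivative f' x) (at x within S)) \<Longrightarrow> C1_on S f"
  unfolding C1_on_def by blast

lemma C1_on_imp_continuous_on: "C1_on S f \<Longrightarrow> continuous_on S f"
  unfolding C1_on_def by (blast intro: DERIV_continuous_on)

lemma C1_on_const: "C1_on S (\<lambda>_. c)"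
  by (rule C1_onI[of S "\<lambda>_. 0"]) auto

lemma C1_on_ident: "C1_on S (\<lambda>x. x)"
  by (rule C1_onI[of S "\<lambda>_. 1"]) auto

lemma C1_on_add:
  assumes "C1_on S f" "C1_on S g" shows "C1_on S (\<lambda>x. f x + g x)"
proof -
  obtain f' g' where "continuous_on S f'" "continuous_on S g'"
    "\<And>x. x \<in> S \<Longrightarrow> (f has_real_derivative f' x) (at x within S)"
    "\<And>x. x \<in> S \<Longrightarrow> (g has_real_derivative g' x) (at x within S)"
    using assms unfolding C1_on_def by metis
  then show ?thesis
    by (intro C1_onI[of S "\<lambda>x. f' x + g' x"] continuous_intros derivative_intros) auto
qed

lemma C1_on_mult:
  assumes "C1_on S f" "C1_on S g" shows "C1_on S (\<lambda>x. f x * g x)"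
proof -
  obtain f' g' where *: "continuous_on S f'" "continuous_on S g'"
    "\<And>x. x \<in> S \<Longrightarrow> (f has_real_derivative f' x) (at x within S)"
    "\<And>x. x \<in> S \<Longrightarrow> (g has_real_derivative g' x) (at x within S)"
    using assms unfolding C1_on_def by metis
  show ?thesis
    by (rule C1_onI[of S "\<lambda>x. f' x * g x + g' x * f x"])
       (intro continuous_intros DERIV_mult *  C1_on_imp_continuous_on assms | assumption)+
qed

lemma C1_on_compose:
  assumes f: "C1_on S f" "\<And>x. x \<in> S \<Longrightarrow> f x \<in> T"
    and F: "continuous_on T F'" "\<And>y. y \<in> T \<Longrightarrow> (F has_real_derivative F' y) (at y)"
  shows "C1_on S (\<lambda>x. F (f x))"
proof -
  obtain f' where f': "continuous_on S f'" "\<And>x. x \<in> S \<Longrightarrow> (f has_real_derivative f' x) (at x within S)"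
    using f unfolding C1_on_def by metis
  have "continuous_on S (\<lambda>x. F' (f x))"
    by (rule continuous_on_compose2[OF F(1) C1_on_imp_continuous_on[OF f(1)]]) (use f in auto)
  then show ?thesis
    using f' f(2) by (intro C1_onI[of S "\<lambda>x. F' (f x) * f' x"] continuous_intros DERIV_chain2[OF F(2)]) auto
qed

lemma C1_on_cong:
  assumes "C1_on S f" "\<And>x. x \<in> S \<Longrightarrow> f x = g x" shows "C1_on S g"
proof -
  obtain f' where "continuous_on S f'" "\<And>x. x \<in> S \<Longrightarrow> (f has_real_derivative f' x) (at x within S)"
    using assms unfolding C1_on_def by metis
  then show ?thesis
    by (intro C1_onI[of S f'] has_field_derivative_transform_within[of f _ _ S 1 g]) (auto simp: assms(2))
qed

lemma C1_on_uminus: "C1_on S f \<Longrightarrow> C1_on S (\<lambda>x. - f x)"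
  using C1_on_mult[OF C1_on_const[of S "-1"], of f] by simp

lemma C1_on_diff: "C1_on S f \<Longrightarrow> C1_on S g \<Longrightarrow> C1_on S (\<lambda>x. f x - g x)"
  using C1_on_add[of S f "\<lambda>x. - g x"] C1_on_uminus[of S g] by simp

lemma C1_on_inverse:
  assumes "C1_on S f" "\<And>x. x \<in> S \<Longrightarrow> f x \<noteq> 0" shows "C1_on S (\<lambda>x. inverse (f x))"
proof (rule C1_on_compose[OF assms(1), of "-{0}" "\<lambda>y. - (inverse y ^ 2)"])
  show "continuous_on (- {0}) (\<lambda>y::real. - (inverse y)\<^sup>2)" by (intro continuous_intros) auto
  show "(inverse has_real_derivative - (inverse y)\<^sup>2) (at y)" if "y \<in> - {0}" for y :: real
    using that by (auto intro!: derivative_eq_intros simp: power2_eq_square)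
qed (use assms in auto)

lemma C1_on_divide:
  "C1_on S f \<Longrightarrow> C1_on S g \<Longrightarrow> (\<And>x. x \<in> S \<Longrightarrow> g x \<noteq> 0) \<Longrightarrow> C1_on S (\<lambda>x. f x / g x)"
  using C1_on_mult[OF _ C1_on_inverse[of S g], of f] by (simp add: divide_inverse)

lemma C1_on_exp: "C1_on S f \<Longrightarrow> C1_on S (\<lambda>x. exp (f x))"
  by (rule C1_on_compose[of S f UNIV exp exp]) (auto intro: continuous_intros derivative_intros)

lemma C1_on_powr:
  assumes "C1_on S f" "\<And>x. x \<in> S \<Longrightarrow> f x > 0" shows "C1_on S (\<lambda>x. f x powr p)"
proof (rule C1_on_compose[OF assms(1), of "{0<..}" "\<lambda>y. p * y powr (p - 1)"])
  show "continuous_on {0<..} (\<lambda>y::real. p * y powr (p - 1))" by (intro continuous_intros) auto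
  show "((\<lambda>y. y powr p) has_real_derivative p * y powr (p - 1)) (at y)" if "y \<in> {0<..}" for y
    using has_real_derivative_powr[of y p] that by simp
qed (use assms in auto)

lemma C1_on_sum: "(\<And>i. i \<in> I \<Longrightarrow> C1_on S (f i)) \<Longrightarrow> C1_on S (\<lambda>x. \<Sum>i\<in>I. f i x)"
  by (induction I rule: infinite_finite_induct) (auto intro: C1_on_const C1_on_add)

lemma C1_on_at:
  assumes "C1_on {a..b} f" "a < x" "x < b"
  obtains f' where "(f has_real_derivative f') (at x)"
  using assms unfolding C1_on_def
  by (metis at_within_Icc_at atLeastAtMost_iff less_imp_le)

lemma C1_on_integral:
  "continuous_on {a..b} f \<Longrightarrow> C1_on {a..b} (\<lambda>x. integral {a..x} f)"
  by (rule C1_onI[of _ f]) (auto intro: integral_has_real_derivative)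

text \<open>The bound is for every derivative at an interior point, since the witness inside
  \<open>C1_on\<close> is not visible to the caller; uniqueness of derivatives identifies the
  two.\<close>

lemma C1_on_derivative_bound:
  assumes "C1_on {a..b} f"
  obtains B where "\<And>x f'. a < x \<Longrightarrow> x < b \<Longrightarrow> (f has_real_derivative f') (at x) \<Longrightarrow> \<bar>f'\<bar> \<le> B"
proof -
  obtain f' where f': "continuous_on {a..b} f'"
    "\<And>x. x \<in> {a..b} \<Longrightarrow> (f has_real_derivative f' x) (at x within {a..b})"
    using assms unfolding C1_on_def by metis
  from f'(1) have "bounded (f' ` {a..b})" by (intro compact_imp_bounded compact_continuous_image) auto
  then obtain B where B: "\<And>x. x \<in> {a..b} \<Longrightarrow> \<bar>f' x\<bar> \<le> B" unfolding bounded_iff by (metis imageI real_norm_def)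
  show ?thesis
  proof
    fix x D assume x: "a < x" "x < b" and D: "(f has_real_derivative D) (at x)"
    have "(f has_real_derivative f' x) (at x)" using f'(2)[of x] x by (simp add: at_within_Icc_at)
    then have "D = f' x" using D DERIV_unique by blast
    then show "\<bar>D\<bar> \<le> B" using B[of x] x by simp
  qed
qed

lemma has_derivative_radial:
  fixes x :: "'a::real_inner"
  assumes "(f has_real_derivative f') (at (norm x))" "x \<noteq> 0"
  shows "((\<lambda>y. f (norm y)) has_derivative (\<lambda>v. f' * (inner x v / norm x))) (at x)"
proof -
  have "((\<lambda>y. f (norm y)) has_derivative (\<lambda>v. f' * inner v (sgn x))) (at x)"
    by (rule has_derivative_compose[OF has_derivative_norm[OF assms(2)], of f "\<lambda>h. f' * h"])
       (use assms(1) in \<open>simp add: has_field_derivative_def\<close>)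
  then show ?thesis by (simp add: sgn_div_norm inner_commute divide_inverse mult_ac)
qed

text \<open>Where \<open>u\<close> vanishes, the difference quotient of the product is
  \<open>a h\<close> times that of \<open>u\<close>, so continuity of \<open>a\<close> suffices.
  This is how the diffusion matrix passes through the divergence undifferentiated.\<close>

lemma DERIV_mult_at_zero:
  fixes u :: "real \<Rightarrow> real"
  assumes "(u has_real_derivative D) (at x)" "u x = 0" "isCont a x"
  shows "((\<lambda>h. a h * u h) has_real_derivative a x * D) (at x)"
proof -
  have "((\<lambda>h. a h * ((u h - u x) / (h - x))) \<longlongrightarrow> a x * D) (at x)"
    using assms by (intro tendsto_mult) (auto simp: has_field_derivative_iff isCont_def)
  then show ?thesis by (simp add: has_field_derivative_iff assms(2))
qed

text \<open>This is a I + b x x^T, with eigenvalue a on the orthogonal complement of x and a + b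
  |x|^2 along x. For fixed x the family is closed under sums and products, so every matrix of the
  problem stays in it.\<close>

definition rmat :: "real \<Rightarrow> real \<Rightarrow> real^'n \<Rightarrow> real^'n^'n" where
  "rmat a b x = (\<chi> i j. (if i = j then a else 0) + b * x $ i * x $ j)"

lemma rmat_mult_vec: "rmat a b x *v v = a *\<^sub>R v + (b * inner x v) *\<^sub>R x"
proof -
  have "(\<Sum>j\<in>UNIV. ((if i = j then a else 0) + b * x $ i * x $ j) * v $ j)
      = (\<Sum>j\<in>UNIV. if i = j then a * v $ j else 0) + (\<Sum>j\<in>UNIV. b * x $ i * x $ j * v $ j)" for i
    unfolding sum.distrib[symmetric] by (intro sum.cong) (auto simp: algebra_simps)
  then show ?thesis
    by (simp add: vec_eq_iff rmat_def matrix_vector_mult_def inner_vec_def sum_distrib_left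
      sum_distrib_right mult_ac)
qed

lemma rmat_mult: "rmat a b x ** rmat a' b' x = rmat (a * a') (a * b' + a' * b + b * b' * (norm x)\<^sup>2) x"
proof -
  have "(rmat a b x ** rmat a' b' x) *v v = rmat (a * a') (a * b' + a' * b + b * b' * (norm x)\<^sup>2) x *v v" for v
    by (simp add: matrix_vector_mul_assoc[symmetric] rmat_mult_vec inner_add_right power2_norm_eq_inner[symmetric]
       algebra_simps scaleR_add_left[symmetric] del: scaleR_add_left)
  then show ?thesis by (simp add: matrix_eq)
qed

lemma rmat_one: "rmat 1 0 x = mat 1"
  by (simp add: rmat_def mat_def vec_eq_iff)

lemma matrix_inv_eqI:
  fixes A :: "real^'n^'n"
  assumes "A ** B = mat 1" "B ** A = mat 1" shows "matrix_inv A = B"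
proof -
  have "A ** matrix_inv A = mat 1"
    unfolding matrix_inv_def by (rule someI2[of _ B]) (use assms in auto)
  then show ?thesis using assms(2) by (metis matrix_mul_assoc matrix_mul_lid matrix_mul_rid)
qed

lemma rmat_inverse:
  assumes "bt \<noteq> 0" "bn \<noteq> 0" "x \<noteq> 0"
  shows "matrix_inv (rmat bt ((bn - bt) / (norm x)\<^sup>2) x) = rmat (1 / bt) ((1 / bn - 1 / bt) / (norm x)\<^sup>2) x"
  using assms by (intro matrix_inv_eqI) (simp_all add: rmat_mult rmat_one[symmetric, of x] field_simps power2_eq_square)

text \<open>\<open>Q\<close> has the square roots of the two eigenvalues of the inverse and is
  symmetric, so Q^T Q = Q^2. This is the factorisation that \<open>trace_hessian_nonpos\<close> asks
  for.\<close>

lemma rmat_sqrt: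
  assumes "bt > 0" "bn > 0" "x \<noteq> 0"
  defines "Q \<equiv> rmat (1 / sqrt bt) ((1 / sqrt bn - 1 / sqrt bt) / (norm x)\<^sup>2) x"
  shows "rmat (1 / bt) ((1 / bn - 1 / bt) / (norm x)\<^sup>2) x $ i $ j = (\<Sum>k\<in>UNIV. Q $ k $ i * Q $ k $ j)"
proof -
  obtain u w where uw: "u > 0" "w > 0" "bt = u\<^sup>2" "bn = w\<^sup>2" "sqrt bt = u" "sqrt bn = w"
    using assms by (metis real_sqrt_gt_zero real_sqrt_pow2 less_imp_le)
  have "Q ** Q = rmat (1 / bt) ((1 / bn - 1 / bt) / (norm x)\<^sup>2) x"
    unfolding Q_def rmat_mult uw using uw assms
    by (intro arg_cong2[of _ _ _ _ "\<lambda>a b. rmat a b x"]) (simp_all add: field_simps power2_eq_square)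
  moreover have "(Q ** Q) $ i $ j = (\<Sum>k\<in>UNIV. Q $ k $ i * Q $ k $ j)"
    unfolding matrix_matrix_mult_def
    by (simp add: Q_def rmat_def mult_ac eq_commute cong: if_cong)
  ultimately show ?thesis by simp
qed

section \<open>The maximum principle for a radial diffusion\<close>

text \<open>\<open>bn\<close> and \<open>bt\<close> are the eigenvalues of \<open>B\<close> in the radial and tangential directions, \<open>br\<close> is the
  radial component of \<open>b\<close>, and \<open>k1\<close>, \<open>k2\<close> describe \<open>A F\<^sub>1 \<^bold>G\<^sub>1'\<close>.\<close>
locale radial_diffusion =
  fixes U :: "(real^'n) set" and N r0 R C0 C2 :: real and bn bt br k1 k2 :: "real \<Rightarrow> real"
  assumes N: "N = real CARD('n)"
    and r0: "0 < r0" and r0R: "r0 < R"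
    and U: "open U" "U \<subseteq> ball 0 R - cball 0 r0"
    and C1: "C1_on {r0..R} bn" "C1_on {r0..R} bt" "C1_on {r0..R} br" "C1_on {r0..R} k1" "C1_on {r0..R} k2"
    and bn_pos: "\<And>r. r \<in> {r0..R} \<Longrightarrow> 0 < bn r" and bt_pos: "\<And>r. r \<in> {r0..R} \<Longrightarrow> 0 < bt r"
    and bn_le: "\<And>r. r \<in> {r0..R} \<Longrightarrow> bn r \<le> C0"
    and br_le: "\<And>r. r \<in> {r0..R} \<Longrightarrow> \<bar>br r\<bar> \<le> C2"
begin

text \<open>An upper bound of |\<open>br r * r\<close>| on the annulus. It makes
  \<open>N + k + br r * r\<close>, the factor in the divergence of the barrier flux, at least
  \<open>N\<close>.\<close>

definition "k = C2 * R"

definition "Lam r = integral {r0..r} br"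

text \<open>A radial function has gradient h'(r) x / r, and A divides x by \<open>bn\<close>; the
  flux - r^k x therefore forces h' = - \<open>bn\<close> r^(k+1). The additive constant makes the
  function positive.\<close>

definition "barrier r = C0 * R powr (k + 2) / (k + 2) - integral {r0..r} (\<lambda>s. bn s * s powr (k + 1))"

text \<open>Chosen so that \<open>rate\<close> times the upper bound of \<open>barrier\<close>
  equals \<open>N * r0 powr k\<close>, the least dissipation that the barrier guarantees.\<close>

definition "rate = N * (k + 2) * r0 powr k / (C0 * R powr (k + 2))"

definition "Am y = rmat (1 / bt (norm y)) ((1 / bn (norm y) - 1 / bt (norm y)) / (norm y)\<^sup>2) y"
  for y :: "real^'n"

definition "bv y = (br (norm y) / norm y) *\<^sub>R y" for y :: "real^'n"

definition "Km y = rmat (k1 (norm y)) (k2 (norm y)) y" for y :: "real^'n"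

section \<open>Elementary properties of the annulus, the potential and the barrier\<close>

lemma norm_U: "y \<in> U \<Longrightarrow> r0 < norm y \<and> norm y < R"
  using U(2) by auto

lemma norm_U': "y \<in> U \<Longrightarrow> norm y \<in> {r0..R} \<and> norm y > 0 \<and> y \<noteq> 0"
  using norm_U[of y] r0 by auto

lemma k_nonneg: "0 \<le> k"
  using br_le[of r0] r0 r0R by (auto simp: k_def intro!: mult_nonneg_nonneg)

lemma C0_pos: "0 < C0"
  using bn_pos[of r0] bn_le[of r0] r0R by auto

lemma N_pos: "0 < N"
  unfolding N by simp

lemma rate_pos: "0 < rate"
  unfolding rate_def using N_pos k_nonneg C0_pos r0 r0R by (intro divide_pos_pos mult_pos_pos) auto

lemma C1_powr': "C1_on {r0..R} (\<lambda>s. s powr p)"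
  using r0 by (intro C1_on_powr C1_on_ident) auto

lemma C1_Lam: "C1_on {r0..R} Lam"
  unfolding Lam_def[abs_def] by (intro C1_on_integral C1_on_imp_continuous_on C1)

lemma cont_flux: "continuous_on {r0..R} (\<lambda>s. bn s * s powr (k + 1))"
  by (intro C1_on_imp_continuous_on C1_on_mult C1 C1_powr')

lemma DERIV_Lam: "r0 < r \<Longrightarrow> r < R \<Longrightarrow> (Lam has_real_derivative br r) (at r)"
  using integral_has_real_derivative[OF C1_on_imp_continuous_on[OF C1(3)], of r]
  unfolding Lam_def[abs_def] by (simp add: at_within_Icc_at)

lemma DERIV_barrier: "r0 < r \<Longrightarrow> r < R \<Longrightarrow> (barrier has_real_derivative - (bn r * r powr (k + 1))) (at r)"
  using integral_has_real_derivative[OF cont_flux, of r]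
  unfolding barrier_def[abs_def] by (auto simp: at_within_Icc_at intro!: derivative_eq_intros)

lemma C1_barrier: "C1_on {r0..R} barrier"
  unfolding barrier_def[abs_def] by (intro C1_on_diff C1_on_const C1_on_integral cont_flux)

text \<open>The integrand lies between 0 and C0 s^(k+1), so the integral lies between 0 and C0
  (R^(k+2) - r0^(k+2)) / (k+2); the constant in \<open>barrier\<close> then leaves exactly the term
  with r0.\<close>

lemma barrier_bounds:
  assumes r: "r \<in> {r0..R}"
  shows "C0 * r0 powr (k + 2) / (k + 2) \<le> barrier r" "barrier r \<le> C0 * R powr (k + 2) / (k + 2)"
proof -
  have k: "k + 2 > 0" using k_nonneg by simp
  have cont: "continuous_on {r0..r} (\<lambda>s. bn s * s powr (k + 1))"
    by (rule continuous_on_subset[OF cont_flux]) (use r in auto)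
  then have int: "(\<lambda>s. bn s * s powr (k + 1)) integrable_on {r0..r}"
    by (rule integrable_continuous_real)
  have pow: "((\<lambda>s. C0 * s powr (k + 1)) has_integral
      C0 * r powr (k + 2) / (k + 2) - C0 * r0 powr (k + 2) / (k + 2)) {r0..r}"
  proof (rule fundamental_theorem_of_calculus)
    fix s assume "s \<in> {r0..r}"
    then have "s > 0" using r0 by simp
    from DERIV_cdivide[OF DERIV_cmult[OF has_real_derivative_powr[OF this, of "k + 2"]], of C0 "k + 2"]
    have "((\<lambda>s. C0 * s powr (k + 2) / (k + 2)) has_real_derivative C0 * s powr (k + 1)) (at s)"
      using k by (simp add: add.commute)
    then show "((\<lambda>s. C0 * s powr (k + 2) / (k + 2)) has_vector_derivative C0 * s powr (k + 1)) (at s within {r0..r})"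
      by (simp add: has_real_derivative_iff_has_vector_derivative has_vector_derivative_at_within)
  qed (use r in auto)
  have 0: "0 \<le> integral {r0..r} (\<lambda>s. bn s * s powr (k + 1))"
    using r by (intro integral_nonneg int) (auto intro!: mult_nonneg_nonneg less_imp_le[OF bn_pos])
  have "integral {r0..r} (\<lambda>s. bn s * s powr (k + 1)) \<le> integral {r0..r} (\<lambda>s. C0 * s powr (k + 1))"
    using r by (intro integral_le int has_integral_integrable[OF pow]) (auto intro!: mult_right_mono bn_le)
  also have "\<dots> = C0 * r powr (k + 2) / (k + 2) - C0 * r0 powr (k + 2) / (k + 2)"
    using pow by (rule integral_unique)
  also have "\<dots> \<le> C0 * R powr (k + 2) / (k + 2) - C0 * r0 powr (k + 2) / (k + 2)"
    using r r0 k C0_pos by (intro diff_right_mono divide_right_mono mult_left_mono powr_mono2) auto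
  finally show "C0 * r0 powr (k + 2) / (k + 2) \<le> barrier r" by (simp add: barrier_def)
  show "barrier r \<le> C0 * R powr (k + 2) / (k + 2)" using 0 by (simp add: barrier_def)
qed

lemma rate_barrier_le:
  assumes "r \<in> {r0..R}" shows "rate * barrier r \<le> N * r0 powr k"
proof -
  have "rate * barrier r \<le> rate * (C0 * R powr (k + 2) / (k + 2))"
    using rate_pos barrier_bounds(2)[OF assms] by (intro mult_left_mono) auto
  also have "\<dots> = N * r0 powr k"
    using C0_pos k_nonneg r0 r0R by (simp add: rate_def)
  finally show ?thesis .
qed

section \<open>Regularity of the radial coefficients and bounds for the forcing\<close>

lemma differentiable_radial:
  fixes x :: "real^'n"
  assumes "C1_on {r0..R} f" "x \<in> U"
  shows "(\<lambda>y. f (norm y)) differentiable (at x)"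
proof -
  obtain f' where "(f has_real_derivative f') (at (norm x))"
    using C1_on_at[OF assms(1), of "norm x"] norm_U[OF assms(2)] by blast
  then show ?thesis using has_derivative_radial[of f f' x] norm_U'[OF assms(2)]
    unfolding differentiable_def by blast
qed

lemma differentiable_component: "(\<lambda>y. y $ j) differentiable (at (x :: real^'n))"
  by (intro linear_imp_differentiable bounded_linear.linear bounded_linear_vec_nth)

lemma isCont_radial: "C1_on {r0..R} f \<Longrightarrow> x \<in> U \<Longrightarrow> isCont (\<lambda>y. f (norm y)) x" for x :: "real^'n"
  using differentiable_radial differentiable_imp_continuous_within by blast

lemma isCont_rmat:
  assumes "C1_on {r0..R} a" "C1_on {r0..R} b" "x \<in> U"
  shows "isCont (\<lambda>y. rmat (a (norm y)) (b (norm y)) y $ i $ j) x"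
  unfolding rmat_def
  using isCont_radial[OF assms(1,3)] isCont_radial[OF assms(2,3)]
  by (cases "i = j") (auto intro!: continuous_intros)

lemma C1_Am: "C1_on {r0..R} (\<lambda>r. 1 / bt r)" "C1_on {r0..R} (\<lambda>r. (1 / bn r - 1 / bt r) / r\<^sup>2)"
proof -
  have 1: "C1_on {r0..R} (\<lambda>r. 1 / bt r)" "C1_on {r0..R} (\<lambda>r. 1 / bn r)"
    using bn_pos bt_pos by (intro C1_on_divide C1_on_const C1; force)+
  moreover have "C1_on {r0..R} (\<lambda>r. r\<^sup>2)" unfolding power2_eq_square by (intro C1_on_mult C1_on_ident)
  ultimately show "C1_on {r0..R} (\<lambda>r. 1 / bt r)" "C1_on {r0..R} (\<lambda>r. (1 / bn r - 1 / bt r) / r\<^sup>2)"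
    using r0 by (auto intro!: C1_on_divide C1_on_diff)
qed

lemma isCont_Am: "x \<in> U \<Longrightarrow> isCont (\<lambda>y. Am y $ i $ j) x"
  unfolding Am_def by (rule isCont_rmat[OF C1_Am])

lemma Am_radial: "y \<in> U \<Longrightarrow> Am y *v (bn (norm y) *\<^sub>R y) = y"
proof -
  assume y: "y \<in> U"
  have "1 / bt (norm y) * bn (norm y) + (1 / bn (norm y) - 1 / bt (norm y)) / (norm y)\<^sup>2 * (bn (norm y) * (norm y)\<^sup>2) = 1"
    using bn_pos[of "norm y"] bt_pos[of "norm y"] norm_U'[OF y] by (simp add: field_simps)
  then have "Am y *v (bn (norm y) *\<^sub>R y) = 1 *\<^sub>R y"
    unfolding Am_def rmat_mult_vec inner_scaleR_right power2_norm_eq_inner[symmetric] scaleR_scaleR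
      scaleR_add_left[symmetric] by metis
  then show ?thesis by simp
qed

text \<open>The flux of the barrier is \<open>- r^k x\<close>; \<open>exp (Lam)\<close> is the integrating factor of the drift.\<close>
lemma barrier_flux_divergence:
  assumes x: "x \<in> U"
  defines "r \<equiv> norm x"
  shows "((\<lambda>h. exp (Lam (norm (x + h *\<^sub>R axis i 1))) * norm (x + h *\<^sub>R axis i 1) powr k * (x + h *\<^sub>R axis i 1) $ i)
      has_real_derivative pd i (\<lambda>y. exp (Lam (norm y)) * norm y powr k * y $ i) x) (at 0)"
    and "(\<Sum>i\<in>UNIV. pd i (\<lambda>y. exp (Lam (norm y)) * norm y powr k * y $ i) x)
      = exp (Lam r) * r powr k * (N + k + br r * r)"
proof -
  have r: "r0 < r" "r < R" "r > 0" "x \<noteq> 0" using norm_U[OF x] norm_U'[OF x] by (auto simp: r_def)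
  let ?m = "\<lambda>r. exp (Lam r) * r powr k"
  let ?m' = "exp (Lam r) * r powr k * (br r + k / r)"
  have "(?m has_real_derivative ?m') (at r)"
    using r by (auto intro!: derivative_eq_intros DERIV_Lam simp: algebra_simps powr_diff)
  then have 1: "((\<lambda>y. ?m (norm y)) has_derivative (\<lambda>v. ?m' * (inner x v / r))) (at x)"
    unfolding r_def by (rule has_derivative_radial) (use r in auto)
  have 2: "((\<lambda>y. ?m (norm y) * y $ i) has_derivative (\<lambda>v. ?m (norm x) * v $ i + ?m' * (inner x v / r) * x $ i)) (at x)" for i
    by (rule has_derivative_mult[OF 1])
       (rule bounded_linear_imp_has_derivative[OF bounded_linear_vec_nth])
  note 3 = has_derivative_pd[OF 2]
  show "((\<lambda>h. exp (Lam (norm (x + h *\<^sub>R axis i 1))) * norm (x + h *\<^sub>R axis i 1) powr k * (x + h *\<^sub>R axis i 1) $ i)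
      has_real_derivative pd i (\<lambda>y. exp (Lam (norm y)) * norm y powr k * y $ i) x) (at 0)"
    unfolding 3(3) by (rule 3(1))
  have "(\<Sum>i\<in>UNIV. pd i (\<lambda>y. exp (Lam (norm y)) * norm y powr k * y $ i) x)
      = (\<Sum>i\<in>UNIV. ?m r + ?m' / r * (x $ i * x $ i))"
    unfolding 3(3) by (simp add: inner_axis r_def mult_ac)
  also have "\<dots> = N * ?m r + ?m' / r * (r * r)"
  proof -
    have "(\<Sum>i\<in>UNIV. x $ i * x $ i) = r * r"
      using power2_norm_eq_inner[of x] by (simp add: inner_vec_def r_def power2_eq_square)
    then show ?thesis unfolding sum.distrib sum_distrib_left[symmetric] by (simp add: N)
  qed
  also have "\<dots> = exp (Lam r) * r powr k * (N + k + br r * r)"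
    using r by (simp add: field_simps)
  finally show "(\<Sum>i\<in>UNIV. pd i (\<lambda>y. exp (Lam (norm y)) * norm y powr k * y $ i) x)
      = exp (Lam r) * r powr k * (N + k + br r * r)" .
qed

text \<open>Only the derivative of the entry (i, j) along axis i occurs in a divergence. The bound
  follows from |x_i| <= |x| <= R; \<open>D1\<close> and \<open>D2\<close> are handed to the caller,
  who can bound them uniformly.\<close>

lemma Km_partial:
  assumes x: "x \<in> U"
  obtains Kd D1 D2 where
    "((\<lambda>h. Km (x + h *\<^sub>R axis i 1) $ i $ j) has_real_derivative Kd) (at 0)"
    "(k1 has_real_derivative D1) (at (norm x))" "(k2 has_real_derivative D2) (at (norm x))"
    "\<bar>Kd\<bar> \<le> \<bar>D1\<bar> + \<bar>D2\<bar> * R\<^sup>2 + 2 * \<bar>k2 (norm x)\<bar> * R"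
proof -
  have r: "r0 < norm x" "norm x < R" "norm x > 0" "x \<noteq> 0" using norm_U[OF x] norm_U'[OF x] by auto
  obtain D1 D2 where D: "(k1 has_real_derivative D1) (at (norm x))" "(k2 has_real_derivative D2) (at (norm x))"
    using C1_on_at[OF C1(4) r(1,2)] C1_on_at[OF C1(5) r(1,2)] by metis
  let ?d = "if i = j then 1 else 0 :: real"
  have nth: "((\<lambda>y::real^'n. y $ i) has_derivative (\<lambda>v. v $ i)) (at x)" for i
    by (rule bounded_linear_imp_has_derivative[OF bounded_linear_vec_nth])
  have Kder: "((\<lambda>y. ?d * k1 (norm y) + k2 (norm y) * y $ i * y $ j) has_derivative
     (\<lambda>v. ?d * (D1 * (inner x v / norm x)) + (k2 (norm x) * x $ i * v $ j
        + (k2 (norm x) * v $ i + D2 * (inner x v / norm x) * x $ i) * x $ j))) (at x)"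
    by (intro has_derivative_add has_derivative_mult has_derivative_mult_right has_derivative_radial D r nth)
  note Kline = has_derivative_pd(1)[OF Kder, of i]
  have ax: "axis i (1::real) $ j = ?d" "axis i (1::real) $ i = 1" by (simp_all add: axis_def)
  show ?thesis
  proof
    let ?Kd = "?d * (D1 * (x $ i / norm x)) + (k2 (norm x) * x $ i * ?d
        + (k2 (norm x) + D2 * (x $ i / norm x) * x $ i) * x $ j)"
    show "(k1 has_real_derivative D1) (at (norm x))" "(k2 has_real_derivative D2) (at (norm x))" by fact+
    show "((\<lambda>h. Km (x + h *\<^sub>R axis i 1) $ i $ j) has_real_derivative ?Kd) (at 0)"
      using Kline ax by (cases "i = j") (simp_all add: Km_def rmat_def inner_axis)
    have xi: "\<bar>x $ i\<bar> \<le> norm x" for i by (rule component_le_norm_cart)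
    have xR: "\<bar>x $ i\<bar> \<le> R" for i using xi[of i] r by linarith
    have q: "\<bar>x $ i / norm x\<bar> \<le> 1" using xi[of i] r by (simp add: abs_divide)
    have d: "\<bar>?d\<bar> \<le> 1" by simp
    have 1: "\<bar>?d * (D1 * (x $ i / norm x))\<bar> \<le> 1 * (\<bar>D1\<bar> * 1)"
      unfolding abs_mult[of ?d] abs_mult[of D1] using d q  by (intro mult_mono) auto
    have 2: "\<bar>k2 (norm x) * x $ i * ?d\<bar> \<le> \<bar>k2 (norm x)\<bar> * R * 1"
      unfolding abs_mult using d xR[of i] r by (intro mult_mono) (auto intro!: mult_nonneg_nonneg)
    have 3: "\<bar>k2 (norm x) * x $ j\<bar> \<le> \<bar>k2 (norm x)\<bar> * R"
      unfolding abs_mult using xR[of j] r by (intro mult_mono) auto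
    have 4: "\<bar>D2 * (x $ i / norm x) * x $ i * x $ j\<bar> \<le> \<bar>D2\<bar> * 1 * R * R"
      unfolding abs_mult using q xR[of j] xR[of i]  r
      by (intro mult_mono) (auto intro!: mult_nonneg_nonneg simp: abs_mult)
    have sum: "\<bar>a + (b + (c + d))\<bar> \<le> E" if "\<bar>a\<bar> \<le> A" "\<bar>b\<bar> \<le> B" "\<bar>c\<bar> \<le> C" "\<bar>d\<bar> \<le> D" "A + B + C + D \<le> E"
      for a b c d A B C D E :: real using that by linarith
    show "\<bar>?Kd\<bar> \<le> \<bar>D1\<bar> + \<bar>D2\<bar> * R\<^sup>2 + 2 * \<bar>k2 (norm x)\<bar> * R"
      unfolding distrib_right by (rule sum[OF 1 2 3 4]) (simp add: power2_eq_square)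
  qed
qed

text \<open>The regularity of \<open>V\<close> enters as existence of partial derivatives, so the
  product rule is applied entry by entry on a coordinate line.\<close>

lemma Km_V_partial:
  assumes x: "x \<in> U" and V: "\<And>j. has_pd i (\<lambda>y. V y $ j) x"
  obtains Kd where "\<And>j. ((\<lambda>h. Km (x + h *\<^sub>R axis i 1) $ i $ j) has_real_derivative Kd j) (at 0)"
    and "((\<lambda>h. (Km (x + h *\<^sub>R axis i 1) *v V (x + h *\<^sub>R axis i 1)) $ i) has_real_derivative
       pd i (\<lambda>y. (Km y *v V y) $ i) x) (at 0)"
    and "pd i (\<lambda>y. (Km y *v V y) $ i) x = (\<Sum>j\<in>UNIV. Kd j * V x $ j + pd i (\<lambda>y. V y $ j) x * Km x $ i $ j)"
proof -
  have "\<exists>Kd. ((\<lambda>h. Km (x + h *\<^sub>R axis i 1) $ i $ j) has_real_derivative Kd) (at 0)" for j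
    using Km_partial[OF x] by metis
  then obtain Kd where Kd: "\<And>j. ((\<lambda>h. Km (x + h *\<^sub>R axis i 1) $ i $ j) has_real_derivative Kd j) (at 0)"
    by metis
  have "((\<lambda>h. V (x + h *\<^sub>R axis i 1) $ j) has_real_derivative pd i (\<lambda>y. V y $ j) x) (at 0)" for j
    using has_pd_line[of i "\<lambda>y. V y $ j" x 0] V by simp
  then have "((\<lambda>h. \<Sum>j\<in>UNIV. Km (x + h *\<^sub>R axis i 1) $ i $ j * V (x + h *\<^sub>R axis i 1) $ j) has_real_derivative
       (\<Sum>j\<in>UNIV. Kd j * V x $ j + pd i (\<lambda>y. V y $ j) x * Km x $ i $ j)) (at 0)"
    using Kd by (intro DERIV_sum DERIV_mult[THEN DERIV_cong]) auto
  then have *: "((\<lambda>h. (Km (x + h *\<^sub>R axis i 1) *v V (x + h *\<^sub>R axis i 1)) $ i) has_real_derivative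
       (\<Sum>j\<in>UNIV. Kd j * V x $ j + pd i (\<lambda>y. V y $ j) x * Km x $ i $ j)) (at 0)"
    by (simp add: matrix_vector_mult_def)
  then have eq: "pd i (\<lambda>y. (Km y *v V y) $ i) x = (\<Sum>j\<in>UNIV. Kd j * V x $ j + pd i (\<lambda>y. V y $ j) x * Km x $ i $ j)"
    unfolding pd_def by (rule DERIV_imp_deriv)
  show ?thesis by (rule that[OF Kd *[folded eq] eq])
qed

text \<open>\<open>V\<close> enters linearly through its values and first derivatives, with factors
  bounded on the annulus. Hence \<open>M\<close> can be chosen before \<open>V\<close>, which makes
  the final constant independent of \<open>V\<close>.\<close>

lemma forcing_bound:
  "\<exists>M\<ge>0. \<forall>x\<in>U. \<forall>V. (\<forall>i j. has_pd i (\<lambda>y. V y $ j) x) \<longrightarrow>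
     \<bar>divg (\<lambda>y. Km y *v V y) x\<bar> \<le> M * (norm (V x) + norm (\<chi> j i. pd i (\<lambda>y. V y $ j) x))"
proof -
  obtain B1 where B1: "\<And>r D. r0 < r \<Longrightarrow> r < R \<Longrightarrow> (k1 has_real_derivative D) (at r) \<Longrightarrow> \<bar>D\<bar> \<le> B1"
    using C1_on_derivative_bound[OF C1(4)] by blast
  obtain B2 where B2: "\<And>r D. r0 < r \<Longrightarrow> r < R \<Longrightarrow> (k2 has_real_derivative D) (at r) \<Longrightarrow> \<bar>D\<bar> \<le> B2"
    using C1_on_derivative_bound[OF C1(5)] by blast
  have "bounded (k1 ` {r0..R})" "bounded (k2 ` {r0..R})"
    by (intro compact_imp_bounded compact_continuous_image C1_on_imp_continuous_on C1 compact_Icc)+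
  then obtain B3 B4 where B3: "\<And>r. r \<in> {r0..R} \<Longrightarrow> \<bar>k1 r\<bar> \<le> B3" and B4: "\<And>r. r \<in> {r0..R} \<Longrightarrow> \<bar>k2 r\<bar> \<le> B4"
    unfolding bounded_iff by (metis imageI real_norm_def)
  \<comment> \<open>\<open>E\<close> dominates both the entries of \<open>Km\<close> and their
    relevant derivatives; the absolute values make it nonnegative without knowing the signs of the
    bounds. The factor \<open>N * N\<close> counts the pairs (i, j).\<close>
  define E where "E = \<bar>B1 + B2 * R\<^sup>2 + 2 * B4 * R\<bar> + \<bar>B3 + B4 * R * R\<bar>"
  show ?thesis
  proof (intro exI[of _ "N * N * E"] conjI ballI allI impI)
    show "N * N * E \<ge> 0" unfolding E_def by simp
    fix x :: "real^'n" and V :: "real^'n \<Rightarrow> real^'n"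
    assume x: "x \<in> U" and "\<forall>i j. has_pd i (\<lambda>y. V y $ j) x"
    then have V: "\<And>i j. has_pd i (\<lambda>y. V y $ j) x" by blast
    have r: "r0 < norm x" "norm x < R" "norm x \<in> {r0..R}" using norm_U[OF x] by auto
    let ?J = "\<chi> j i. pd i (\<lambda>y. V y $ j) x"
    have K: "\<bar>Km x $ i $ j\<bar> \<le> E" for i j
    proof -
      have xR: "\<bar>x $ i\<bar> \<le> R" for i using component_le_norm_cart[of x i] r by linarith
      have "\<bar>k2 (norm x) * x $ i * x $ j\<bar> \<le> B4 * R * R"
        unfolding abs_mult using xR[of i] xR[of j] B4[OF r(3)]
        by (intro mult_mono) (auto intro!: mult_nonneg_nonneg)
      moreover have "\<bar>if i = j then k1 (norm x) else 0\<bar> \<le> B3" using B3[OF r(3)] by auto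
      ultimately show ?thesis unfolding E_def Km_def rmat_def by simp
    qed
    have "\<bar>pd i (\<lambda>y. (Km y *v V y) $ i) x\<bar> \<le> (\<Sum>j\<in>(UNIV::'n set). E * (norm (V x) + norm ?J))" for i
    proof -
      obtain Kd where Kd: "\<And>j. ((\<lambda>h. Km (x + h *\<^sub>R axis i 1) $ i $ j) has_real_derivative Kd j) (at 0)"
       and "((\<lambda>h. (Km (x + h *\<^sub>R axis i 1) *v V (x + h *\<^sub>R axis i 1)) $ i) has_real_derivative
         pd i (\<lambda>y. (Km y *v V y) $ i) x) (at 0)"
       and eq: "pd i (\<lambda>y. (Km y *v V y) $ i) x = (\<Sum>j\<in>UNIV. Kd j * V x $ j + pd i (\<lambda>y. V y $ j) x * Km x $ i $ j)"
        by (rule Km_V_partial[OF x, of i V, OF V]) (rule that)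
      have KdE: "\<bar>Kd j\<bar> \<le> E" for j
      proof -
        obtain D D1 D2 where D: "((\<lambda>h. Km (x + h *\<^sub>R axis i 1) $ i $ j) has_real_derivative D) (at 0)"
          and D12: "(k1 has_real_derivative D1) (at (norm x))" "(k2 has_real_derivative D2) (at (norm x))"
          and bound: "\<bar>D\<bar> \<le> \<bar>D1\<bar> + \<bar>D2\<bar> * R\<^sup>2 + 2 * \<bar>k2 (norm x)\<bar> * R"
          by (rule Km_partial[OF x, of i j]) (rule that)
        have "\<bar>D1\<bar> + \<bar>D2\<bar> * R\<^sup>2 + 2 * \<bar>k2 (norm x)\<bar> * R \<le> B1 + B2 * R\<^sup>2 + 2 * B4 * R"
          using B1[OF r(1,2) D12(1)] B2[OF r(1,2) D12(2)] B4[OF r(3)] r0 r0R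
          by (intro add_mono mult_right_mono mult_left_mono) auto
        then have "\<bar>D\<bar> \<le> B1 + B2 * R\<^sup>2 + 2 * B4 * R" using bound by linarith
        moreover have "D = Kd j" using DERIV_unique[OF D Kd] .
        ultimately show ?thesis unfolding E_def by simp
      qed
      show ?thesis unfolding eq
      proof (rule order_trans[OF sum_abs sum_mono])
        fix j
        have "\<bar>V x $ j\<bar> \<le> norm (V x)" by (rule component_le_norm_cart)
        then have 1: "\<bar>Kd j * V x $ j\<bar> \<le> E * norm (V x)"
          unfolding abs_mult using KdE[of j] by (intro mult_mono) auto
        have "\<bar>?J $ j $ i\<bar> \<le> norm ?J"
          using component_le_norm_cart[of "?J $ j" i] Finite_Cartesian_Product.norm_nth_le[of ?J j] by linarith
        then have 2: "\<bar>pd i (\<lambda>y. V y $ j) x * Km x $ i $ j\<bar> \<le> norm ?J * E"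
          unfolding abs_mult using K[of i j] by (intro mult_mono) auto
        show "\<bar>Kd j * V x $ j + pd i (\<lambda>y. V y $ j) x * Km x $ i $ j\<bar> \<le> E * (norm (V x) + norm ?J)"
          using 1 2 by (simp add: algebra_simps)
      qed
    qed
    then have "\<bar>divg (\<lambda>y. Km y *v V y) x\<bar> \<le> (\<Sum>i\<in>(UNIV::'n set). \<Sum>j\<in>(UNIV::'n set). E * (norm (V x) + norm ?J))"
      unfolding divg_def by (intro order_trans[OF sum_abs sum_mono])
    then show "\<bar>divg (\<lambda>y. Km y *v V y) x\<bar> \<le> N * N * E * (norm (V x) + norm ?J)"
      by (simp add: N algebra_simps)
  qed
qed

text \<open>Time is frozen here: \<open>s\<close> is a slice of the solution and
  \<open>\<tau>\<close> the current height of the barrier. The flux splits into that of the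
  difference, whose divergence at the maximum has a sign, the explicit flux of the barrier, and the
  forcing; \<open>sg\<close> treats upper and lower bounds together.\<close>

lemma max_principle_interior:
  fixes s :: "real^'n \<Rightarrow> real"
  assumes x: "x \<in> U" and sg: "sg = 1 \<or> sg = (-1::real)"
    and s: "\<And>y. y \<in> U \<Longrightarrow> (s has_derivative (\<lambda>v. \<Sum>j\<in>UNIV. v $ j * pd j s y)) (at y)"
    and ds: "\<And>j. pd j s differentiable (at x)"
    and V: "\<And>i j. has_pd i (\<lambda>y. V y $ j) x"
    and mx: "\<And>y. y \<in> U \<Longrightarrow> sg * exp (- Lam (norm y)) * s y - \<tau> * barrier (norm y)
        \<le> sg * exp (- Lam (norm x)) * s x - \<tau> * barrier (norm x)"
  shows "sg * divg (\<lambda>y. Am y *v (grad s y - s y *\<^sub>R bv y) + Km y *v V y) x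
    \<le> - (exp (Lam (norm x)) * \<tau> * norm x powr k * (N + k + br (norm x) * norm x))
       + \<bar>divg (\<lambda>y. Km y *v V y) x\<bar>"
proof -
  have sg2: "sg * (sg * a) = a" "\<bar>sg * a\<bar> = \<bar>a\<bar>" for a using sg by auto
  \<comment> \<open>\<open>G\<close> is the gradient of the function \<open>Z\<close> that is maximal at \<open>x\<close>. As \<open>G\<close> vanishes there, the
    derivatives of \<open>A\<close> do not contribute to the divergence.\<close>
  define G where "G j y = sg * exp (- Lam (norm y)) * (pd j s y - s y * (br (norm y) / norm y * y $ j))
     + \<tau> * (bn (norm y) * norm y powr k * y $ j)" for j y
  define Z where "Z y = sg * exp (- Lam (norm y)) * s y - \<tau> * barrier (norm y)" for y
  have Z: "(Z has_derivative (\<lambda>v. \<Sum>j\<in>UNIV. v $ j * G j y)) (at y)" if y: "y \<in> U" for y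
  proof -
    have r: "r0 < norm y" "norm y < R" "norm y > 0" "y \<noteq> 0" using norm_U[OF y] norm_U'[OF y] by auto
    have "((\<lambda>r. sg * exp (- Lam r)) has_real_derivative - (sg * exp (- Lam (norm y)) * br (norm y))) (at (norm y))"
      using r by (auto intro!: derivative_eq_intros DERIV_Lam)
    note 1 = has_derivative_radial[OF this r(4)]
    note 2 = has_derivative_radial[OF DERIV_barrier[OF r(1,2)] r(4)]
    have "(Z has_derivative (\<lambda>v. (sg * exp (- Lam (norm y)) * (\<Sum>j\<in>UNIV. v $ j * pd j s y)
       + - (sg * exp (- Lam (norm y)) * br (norm y)) * (inner y v / norm y) * s y)
       - \<tau> * (- (bn (norm y) * norm y powr (k + 1)) * (inner y v / norm y)))) (at y)"
      unfolding Z_def by (intro has_derivative_diff has_derivative_mult has_derivative_mult_right 1 2 s y)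
    moreover have "(\<Sum>j\<in>UNIV. v $ j * G j y) = sg * exp (- Lam (norm y)) * (\<Sum>j\<in>UNIV. v $ j * pd j s y)
       + - (sg * exp (- Lam (norm y)) * br (norm y)) * (inner y v / norm y) * s y
       - \<tau> * (- (bn (norm y) * norm y powr (k + 1)) * (inner y v / norm y))" for v
    proof -
      let ?c = "- (sg * exp (- Lam (norm y)) * br (norm y)) * s y / norm y + \<tau> * (bn (norm y) * norm y powr k)"
      have "v $ j * G j y = sg * exp (- Lam (norm y)) * (v $ j * pd j s y) + ?c * (y $ j * v $ j)" for j
        by (simp add: G_def algebra_simps)
      then have "(\<Sum>j\<in>UNIV. v $ j * G j y) =
          sg * exp (- Lam (norm y)) * (\<Sum>j\<in>UNIV. v $ j * pd j s y) + ?c * inner y v"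
        by (simp add: sum.distrib sum_distrib_left inner_vec_def)
      moreover have "norm y powr (k + 1) = norm y powr k * norm y" using r by (simp add: powr_add)
      ultimately show ?thesis using r by (simp add: field_simps)
    qed
    ultimately show ?thesis by (simp only:)
  qed
  have "G j differentiable (at x)" for j
  proof -
    have "C1_on {r0..R} (\<lambda>r. sg * exp (- Lam r))" "C1_on {r0..R} (\<lambda>r. br r / r)" "C1_on {r0..R} (\<lambda>r. bn r * r powr k)"
      using r0 by (auto intro!: C1_on_mult C1_on_const C1_on_exp C1_on_uminus C1_Lam C1_on_divide C1 C1_on_ident C1_powr')
    note rad = this[THEN differentiable_radial, OF x]
    have "s differentiable (at x)" using s[OF x] by (auto simp: differentiable_def)
    then show ?thesis unfolding G_def[abs_def]
      by (intro differentiable_add differentiable_mult differentiable_diff rad ds differentiable_component) auto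
  qed
  then obtain D where D: "\<And>j. (G j has_derivative D j) (at x)" unfolding differentiable_def by metis
  have mxZ: "\<And>y. y \<in> U \<Longrightarrow> Z y \<le> Z x" unfolding Z_def by (rule mx)
  note hess = hessian_nonpos_at_max[OF U(1) x Z D mxZ]
  define F where "F y = exp (Lam (norm y)) * norm y powr k" for y :: "real^'n"
  \<comment> \<open>Solving the definition of \<open>G\<close> for
    \<open>grad s y - s y *\<^sub>R bv y\<close> absorbs the drift: what remains is a multiple of
    \<open>G\<close> and a multiple of \<open>bn (norm y) *\<^sub>R y\<close>, which
    \<open>Am\<close> maps to a multiple of \<open>y\<close>.\<close>
  have W: "(Am y *v (grad s y - s y *\<^sub>R bv y) + Km y *v V y) $ i =
      sg * (\<Sum>j\<in>UNIV. (exp (Lam (norm y)) * Am y $ i $ j) * G j y) - sg * \<tau> * (F y * y $ i) + (Km y *v V y) $ i"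
    if y: "y \<in> U" for y i
  proof -
    have "grad s y - s y *\<^sub>R bv y = (sg * exp (Lam (norm y))) *\<^sub>R (\<chi> j. G j y)
       - (sg * \<tau> * F y) *\<^sub>R (bn (norm y) *\<^sub>R y)"
      using sg by (auto simp: vec_eq_iff grad_def bv_def G_def F_def exp_minus field_simps)
    moreover have "Am y *v (c *\<^sub>R (bn (norm y) *\<^sub>R y)) = c *\<^sub>R y" for c
      by (subst matrix_vector_mult_scaleR) (simp only: Am_radial[OF y])
    ultimately have "Am y *v (grad s y - s y *\<^sub>R bv y) = (sg * exp (Lam (norm y))) *\<^sub>R (Am y *v (\<chi> j. G j y)) - (sg * \<tau> * F y) *\<^sub>R y"
      by (simp only: matrix_vector_mult_diff_distrib matrix_vector_mult_scaleR)
    then show ?thesis by (simp add: matrix_vector_mult_def sum_distrib_left mult_ac)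
  qed
  have pdW: "pd i (\<lambda>y. (Am y *v (grad s y - s y *\<^sub>R bv y) + Km y *v V y) $ i) x =
      sg * (\<Sum>j\<in>UNIV. exp (Lam (norm x)) * Am x $ i $ j * D j (axis i 1))
      - sg * \<tau> * pd i (\<lambda>y. F y * y $ i) x + pd i (\<lambda>y. (Km y *v V y) $ i) x" for i
  proof -
    let ?l = "\<lambda>h. x + h *\<^sub>R axis i (1::real)"
    have KV: "((\<lambda>h. (Km (?l h) *v V (?l h)) $ i) has_real_derivative pd i (\<lambda>y. (Km y *v V y) $ i) x) (at 0)"
      by (rule Km_V_partial[OF x, of i V]) (rule V)
    have cl: "isCont ?l 0" by (intro continuous_intros)
    have "isCont (\<lambda>y. exp (Lam (norm y)) * Am y $ i $ j) x" for j
      by (intro isCont_mult isCont_Am isCont_radial[OF C1_on_exp[OF C1_Lam]] x)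
    then have A: "isCont (\<lambda>h. exp (Lam (norm (?l h))) * Am (?l h) $ i $ j) 0" for j
      by (intro isCont_o2[OF cl, of "\<lambda>y. exp (Lam (norm y)) * Am y $ i $ j"]) simp
    have AG: "((\<lambda>h. exp (Lam (norm (?l h))) * Am (?l h) $ i $ j * G j (?l h)) has_real_derivative
        exp (Lam (norm x)) * Am x $ i $ j * D j (axis i 1)) (at 0)" for j
      using DERIV_mult_at_zero[OF has_derivative_pd(1)[OF D] _ A] hess(1) by simp
    have "((\<lambda>h. sg * (\<Sum>j\<in>UNIV. exp (Lam (norm (?l h))) * Am (?l h) $ i $ j * G j (?l h))
        - sg * \<tau> * (F (?l h) * ?l h $ i) + (Km (?l h) *v V (?l h)) $ i) has_real_derivative
        sg * (\<Sum>j\<in>UNIV. exp (Lam (norm x)) * Am x $ i $ j * D j (axis i 1))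
      - sg * \<tau> * pd i (\<lambda>y. F y * y $ i) x + pd i (\<lambda>y. (Km y *v V y) $ i) x) (at 0)"
      unfolding F_def
      by (intro DERIV_add DERIV_diff DERIV_cmult DERIV_sum barrier_flux_divergence(1) x AG KV)
    then have "pd i (\<lambda>y. sg * (\<Sum>j\<in>UNIV. exp (Lam (norm y)) * Am y $ i $ j * G j y)
        - sg * \<tau> * (F y * y $ i) + (Km y *v V y) $ i) x =
        sg * (\<Sum>j\<in>UNIV. exp (Lam (norm x)) * Am x $ i $ j * D j (axis i 1))
      - sg * \<tau> * pd i (\<lambda>y. F y * y $ i) x + pd i (\<lambda>y. (Km y *v V y) $ i) x"
      unfolding pd_def[of i "\<lambda>y. sg * (\<Sum>j\<in>UNIV. exp (Lam (norm y)) * Am y $ i $ j * G j y)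
        - sg * \<tau> * (F y * y $ i) + (Km y *v V y) $ i"] by (rule DERIV_imp_deriv)
    then show ?thesis using pd_cong_open[OF U(1) x W] by simp
  qed
  have tr: "(\<Sum>i\<in>UNIV. \<Sum>j\<in>UNIV. Am x $ i $ j * D j (axis i 1)) \<le> 0"
    unfolding Am_def using norm_U'[OF x] bn_pos[of "norm x"] bt_pos[of "norm x"]
    by (subst rmat_sqrt) (auto intro!: trace_hessian_nonpos hess(2) has_derivative_linear[OF D])
  have "sg * divg (\<lambda>y. Am y *v (grad s y - s y *\<^sub>R bv y) + Km y *v V y) x
     = exp (Lam (norm x)) * (\<Sum>i\<in>UNIV. \<Sum>j\<in>UNIV. Am x $ i $ j * D j (axis i 1))
       - \<tau> * (\<Sum>i\<in>UNIV. pd i (\<lambda>y. F y * y $ i) x) + sg * divg (\<lambda>y. Km y *v V y) x"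
    unfolding divg_def pdW sum.distrib sum_subtractf
    by (simp add: distrib_left right_diff_distrib sum_distrib_left[symmetric] mult.assoc sg2)
  also have "(\<Sum>i\<in>UNIV. pd i (\<lambda>y. F y * y $ i) x) = exp (Lam (norm x)) * norm x powr k * (N + k + br (norm x) * norm x)"
    unfolding F_def by (rule barrier_flux_divergence(2)[OF x])
  also have "exp (Lam (norm x)) * (\<Sum>i\<in>UNIV. \<Sum>j\<in>UNIV. Am x $ i $ j * D j (axis i 1)) \<le> 0"
    using tr by (simp add: mult_nonneg_nonpos)
  also have "sg * divg (\<lambda>y. Km y *v V y) x \<le> \<bar>divg (\<lambda>y. Km y *v V y) x\<bar>"
    using abs_ge_self[of "sg * divg (\<lambda>y. Km y *v V y) x"] sg2(2) by simp
  finally show ?thesis by (simp add: mult_ac)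
qed

end

section \<open>Time slices of a solution and maxima at the final time\<close>

lemma continuous_on_slice:
  assumes "continuous_on (A \<times> B) (\<lambda>(x,t). f x t)" "t \<in> B"
  shows "continuous_on A (\<lambda>x. f x t)"
proof -
  have "continuous_on A (\<lambda>x. (x, t))" by (intro continuous_intros)
  moreover have "(\<lambda>x. (x, t)) ` A \<subseteq> A \<times> B" using assms(2) by auto
  ultimately show ?thesis using continuous_on_compose2[OF assms(1)] by fastforce
qed

text \<open>\<open>has_derivative_of_partials\<close> is used twice, for the slice itself and for
  each of its first partial derivatives; this turns \<open>C21\<close> into the total derivatives
  needed at a maximum.\<close>

lemma C21_slice:
  fixes \<sigma> :: "real^'n \<Rightarrow> real \<Rightarrow> real"
  assumes U: "open U" and C: "C21 U \<sigma>" and t: "t > 0" and y: "y \<in> U"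
  shows "((\<lambda>z. \<sigma> z t) has_derivative (\<lambda>v. \<Sum>j\<in>UNIV. v $ j * pd j (\<lambda>z. \<sigma> z t) y)) (at y)"
    and "pd j (\<lambda>z. \<sigma> z t) differentiable (at y)"
    and "(\<sigma> y has_real_derivative deriv (\<sigma> y) t) (at t)"
proof -
  have slice: "continuous_on U (ipd is (\<lambda>z. \<sigma> z t))" if "length is \<le> 2" for "is"
  proof -
    have "continuous_on (U \<times> {0<..}) (\<lambda>(x,t). ipd is (\<lambda>y. \<sigma> y t) x)" using C that by (simp add: C21_def)
    from continuous_on_slice[OF this] show ?thesis using t by simp
  qed
  have pd: "has_pd i (ipd is (\<lambda>z. \<sigma> z t)) y" if "length is < 2" "y \<in> U" for i "is" y
    using C t that by (simp add: C21_def)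
  show "((\<lambda>z. \<sigma> z t) has_derivative (\<lambda>v. \<Sum>j\<in>UNIV. v $ j * pd j (\<lambda>z. \<sigma> z t) y)) (at y)"
    using has_derivative_of_partials[OF U y, of "\<lambda>z. \<sigma> z t"] pd[of "[]"] slice[of "[_]"] by simp
  have "(pd j (\<lambda>z. \<sigma> z t) has_derivative (\<lambda>v. \<Sum>i\<in>UNIV. v $ i * pd i (pd j (\<lambda>z. \<sigma> z t)) y)) (at y)"
    using has_derivative_of_partials[OF U y, of "pd j (\<lambda>z. \<sigma> z t)"] pd[of "[j]"] slice[of "[_, j]"] by simp
  then show "pd j (\<lambda>z. \<sigma> z t) differentiable (at y)" by (rule differentiableI)
  show "(\<sigma> y has_real_derivative deriv (\<sigma> y) t) (at t)"
    using C t y by (simp add: C21_def DERIV_deriv_iff_field_differentiable)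
qed

text \<open>A maximum over space and time may sit at the final time, where the time derivative need
  not vanish and only its sign is determined.\<close>

lemma DERIV_nonneg_at_left_max:
  fixes \<phi> :: "real \<Rightarrow> real"
  assumes "(\<phi> has_real_derivative D) (at t)" "a < t" "\<And>s. a \<le> s \<Longrightarrow> s \<le> t \<Longrightarrow> \<phi> s \<le> \<phi> t"
  shows "0 \<le> D"
proof (rule ccontr)
  assume "\<not> 0 \<le> D"
  then obtain d where d: "d > 0" "\<And>h. 0 < h \<Longrightarrow> h < d \<Longrightarrow> \<phi> t < \<phi> (t - h)"
    using DERIV_neg_dec_left[OF assms(1)] by auto
  have "\<phi> t < \<phi> (t - min (d / 2) (t - a))" using d assms(2) by (intro d(2)) (auto simp: min_def)
  then show False using assms(3)[of "t - min (d / 2) (t - a)"] d(1) assms(2) by (auto simp: min_def split: if_splits)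
qed

section \<open>Comparison of solutions with the decaying barrier\<close>

context radial_diffusion begin

lemma closure_U: "x \<in> closure U \<Longrightarrow> norm x \<in> {r0..R}"
proof -
  have "closure U \<subseteq> cball 0 R - ball 0 r0"
    using U(2) by (intro closure_minimal) (auto intro: closed_Diff)
  then show "x \<in> closure U \<Longrightarrow> norm x \<in> {r0..R}" by auto
qed

lemma compact_closure_U: "compact (closure U)"
proof -
  have "bounded U" using U(2) by (rule_tac bounded_subset[of "ball 0 R"]) auto
  then show ?thesis by (simp add: compact_eq_bounded_closed bounded_closure)
qed

text \<open>The starting time \<open>T0\<close> restricts only the equation and the regularity of
  \<open>V\<close>, so the estimate can be restarted from a later time. Initial and boundary values
  are left to the individual estimates.\<close>

definition solution :: "(real^'n \<Rightarrow> real \<Rightarrow> real) \<Rightarrow> (real^'n \<Rightarrow> real \<Rightarrow> real^'n) \<Rightarrow> real \<Rightarrow> bool" where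
  "solution \<sigma> V T0 \<longleftrightarrow> 0 \<le> T0 \<and> continuous_on (closure U \<times> {0..}) (\<lambda>(x,t). \<sigma> x t) \<and> C21 U \<sigma>
    \<and> (\<forall>x\<in>U. \<forall>t>T0. \<forall>i j. has_pd i (\<lambda>y. V y t $ j) x)
    \<and> (\<forall>x\<in>U. \<forall>t>T0. deriv (\<sigma> x) t =
        divg (\<lambda>y. Am y *v (grad (\<lambda>z. \<sigma> z t) y - \<sigma> y t *\<^sub>R bv y) + Km y *v V y t) x)"

text \<open>A positive maximum of the difference over the closed cylinder is excluded at the initial
  time by the choice of \<open>\<alpha>\<close>, on the lateral boundary by that of
  \<open>\<gamma>\<close>, and inside by the equation. The strict inequality between
  \<open>\<gamma>\<close> and the forcing turns the interior case into a contradiction.\<close>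

lemma comparison:
  fixes \<sigma> :: "real^'n \<Rightarrow> real \<Rightarrow> real" and V :: "real^'n \<Rightarrow> real \<Rightarrow> real^'n"
  assumes sg: "sg = 1 \<or> sg = (-1::real)" and sol: "solution \<sigma> V T0"
    and init: "\<And>x. x \<in> U \<Longrightarrow> \<bar>\<sigma> x T0\<bar> \<le> m0"
    and bdry: "\<And>x t. x \<in> frontier U \<Longrightarrow> t > T0 \<Longrightarrow> \<bar>\<sigma> x t\<bar> \<le> m2"
    and force: "\<And>x t. x \<in> U \<Longrightarrow> t > T0 \<Longrightarrow> \<bar>divg (\<lambda>y. Km y *v V y t) x\<bar> \<le> m1"
    and L: "\<And>r. r \<in> {r0..R} \<Longrightarrow> \<bar>Lam r\<bar> \<le> L"
    and \<alpha>: "0 \<le> \<alpha>" "exp L * m0 \<le> \<alpha> * (C0 * r0 powr (k + 2) / (k + 2))"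
    and \<gamma>: "0 \<le> \<gamma>" "exp L * m2 \<le> \<gamma> * (C0 * r0 powr (k + 2) / (k + 2))" "exp L * m1 < \<gamma> * (N * r0 powr k)"
    and x: "x \<in> U" and t: "T0 \<le> t"
  shows "sg * exp (- Lam (norm x)) * \<sigma> x t \<le> (\<alpha> * exp (- rate * (t - T0)) + \<gamma>) * barrier (norm x)"
proof -
  have T0: "0 \<le> T0" and cont: "continuous_on (closure U \<times> {0..}) (\<lambda>(x,t). \<sigma> x t)" and C21: "C21 U \<sigma>"
    and V: "\<And>x t i j. x \<in> U \<Longrightarrow> t > T0 \<Longrightarrow> has_pd i (\<lambda>y. V y t $ j) x"
    and pde: "\<And>x t. x \<in> U \<Longrightarrow> t > T0 \<Longrightarrow> deriv (\<sigma> x) t =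
        divg (\<lambda>y. Am y *v (grad (\<lambda>z. \<sigma> z t) y - \<sigma> y t *\<^sub>R bv y) + Km y *v V y t) x"
    using sol by (auto simp: solution_def)
  define \<tau> where "\<tau> s = \<alpha> * exp (- rate * (s - T0)) + \<gamma>" for s
  define Z where "Z y s = sg * exp (- Lam (norm y)) * \<sigma> y s - \<tau> s * barrier (norm y)" for y s
  have \<tau>_ge: "\<tau> s \<ge> \<gamma>" for s using \<alpha>(1) by (simp add: \<tau>_def)
  define hm where "hm = C0 * r0 powr (k + 2) / (k + 2)"
  have hm: "hm > 0" using C0_pos k_nonneg r0 by (simp add: hm_def)
  note barrier_ge = barrier_bounds(1)[folded hm_def] and \<alpha>2 = \<alpha>(2)[folded hm_def] and \<gamma>2 = \<gamma>(2)[folded hm_def]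
  \<comment> \<open>This serves the initial slice and the lateral boundary alike: the integrating
    factor costs at most \<open>exp L\<close>, and \<open>hm\<close> bounds the barrier from
    below.\<close>
  have small: "Z y s \<le> 0" if y: "y \<in> closure U" and b: "\<bar>\<sigma> y s\<bar> \<le> m" "exp L * m \<le> \<tau> s * hm" for y s m
  proof -
    have "sg * exp (- Lam (norm y)) * \<sigma> y s \<le> exp L * m"
    proof -
      have "sg * exp (- Lam (norm y)) * \<sigma> y s \<le> \<bar>sg * exp (- Lam (norm y)) * \<sigma> y s\<bar>" by simp
      also have "\<dots> = exp (- Lam (norm y)) * \<bar>\<sigma> y s\<bar>" using sg by (auto simp: abs_mult)
      also have "\<dots> \<le> exp L * m"
        using L[OF closure_U[OF y]] b(1) by (intro mult_mono) auto
      finally show ?thesis .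
    qed
    also have "\<dots> \<le> \<tau> s * hm" by (rule b)
    also have "\<dots> \<le> \<tau> s * barrier (norm y)"
      using \<tau>_ge[of s] \<gamma>(1) barrier_ge[OF closure_U[OF y]] by (intro mult_left_mono) auto
    finally show ?thesis by (simp add: Z_def)
  qed
  have contZ: "continuous_on (closure U \<times> {T0..t}) (\<lambda>(y, s). Z y s)"
  proof -
    have rad: "continuous_on (closure U \<times> {T0..t}) (\<lambda>p. f (norm (fst p)))" if "C1_on {r0..R} f" for f
      using closure_U by (intro continuous_on_compose2[OF C1_on_imp_continuous_on[OF that]] continuous_intros) auto
    have "continuous_on (closure U \<times> {T0..t}) (\<lambda>p. \<sigma> (fst p) (snd p))"
      unfolding case_prod_beta[symmetric] by (rule continuous_on_subset[OF cont]) (use T0 in auto)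
    then show ?thesis unfolding case_prod_beta Z_def \<tau>_def
      by (intro continuous_intros rad C1_Lam C1_barrier)
  qed
  have ne: "closure U \<times> {T0..t} \<noteq> {}" using x t closure_subset[of U] by auto
  obtain p where "p \<in> closure U \<times> {T0..t}" "\<And>q. q \<in> closure U \<times> {T0..t} \<Longrightarrow> (\<lambda>(y, s). Z y s) q \<le> (\<lambda>(y, s). Z y s) p"
    using continuous_attains_sup[OF compact_Times[OF compact_closure_U compact_Icc] ne contZ] by blast
  moreover obtain xm tm where "p = (xm, tm)" by (cases p)
  ultimately have p: "xm \<in> closure U" "T0 \<le> tm" "tm \<le> t"
    and mx: "\<And>y s. y \<in> closure U \<Longrightarrow> T0 \<le> s \<Longrightarrow> s \<le> t \<Longrightarrow> Z y s \<le> Z xm tm" by auto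
  have "Z xm tm \<le> 0"
  proof (rule ccontr)
    assume pos: "\<not> Z xm tm \<le> 0"
    have "tm \<noteq> T0"
    proof
      assume [simp]: "tm = T0"
      have "continuous_on (closure U) (\<lambda>y. \<sigma> y T0)"
        using continuous_on_slice[OF cont] T0 by simp
      then have "norm (\<sigma> xm T0) \<le> m0"
        using init p(1) by (intro continuous_on_closure_norm_le[of U "\<lambda>y. \<sigma> y T0"]) auto
      moreover have "exp L * m0 \<le> \<tau> T0 * hm"
        using \<alpha>2 mult_nonneg_nonneg[OF \<gamma>(1) less_imp_le[OF hm]] by (simp add: \<tau>_def distrib_right)
      ultimately have "Z xm T0 \<le> 0" by (intro small[OF p(1)]) simp_all
      then show False using pos by simp
    qed
    then have tm: "T0 < tm" using p by simp
    have "xm \<notin> frontier U"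
    proof
      assume "xm \<in> frontier U"
      from bdry[OF this tm] have "\<bar>\<sigma> xm tm\<bar> \<le> m2" .
      then have "Z xm tm \<le> 0"
      proof (rule small[OF p(1)])
        show "exp L * m2 \<le> \<tau> tm * hm"
        using \<gamma>2 mult_right_mono[OF \<tau>_ge[of tm], of hm] hm by linarith
      qed
      then show False using pos by simp
    qed
    then have xm: "xm \<in> U" using p(1) U(1) by (simp add: frontier_def interior_open)
    let ?r = "norm xm" let ?e = "exp (Lam (norm xm))"
    note r = norm_U[OF xm] norm_U'[OF xm]
    have tm0: "tm > 0" using tm T0 by simp
    note sl = C21_slice[OF U(1) C21 tm0]
    have "sg * deriv (\<sigma> xm) tm \<le> - (?e * \<tau> tm * ?r powr k * (N + k + br ?r * ?r))
       + \<bar>divg (\<lambda>y. Km y *v V y tm) xm\<bar>"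
      unfolding pde[OF xm tm]
      by (rule max_principle_interior[OF xm sg sl(1) sl(2)[OF xm] V[OF xm tm]])
         (use mx[of _ tm] p closure_subset[of U] in \<open>auto simp: Z_def\<close>)
    then have 1: "sg * deriv (\<sigma> xm) tm \<le> - (?e * \<tau> tm * ?r powr k * (N + k + br ?r * ?r)) + m1"
      using force[OF xm tm] by simp
    \<comment> \<open>The time derivative of \<open>\<tau>\<close> is
      \<open>- rate * (\<tau> tm - \<gamma>)\<close>, since only its exponential part
      varies.\<close>
    have 2: "0 \<le> sg * exp (- Lam ?r) * deriv (\<sigma> xm) tm + rate * (\<tau> tm - \<gamma>) * barrier ?r"
    proof (rule DERIV_nonneg_at_left_max[OF _ tm, of "Z xm"])
      show "(Z xm has_real_derivative sg * exp (- Lam ?r) * deriv (\<sigma> xm) tm + rate * (\<tau> tm - \<gamma>) * barrier ?r) (at tm)"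
        unfolding Z_def \<tau>_def
        by (auto intro!: derivative_eq_intros sl(3)[OF xm] simp: algebra_simps)
      show "Z xm s \<le> Z xm tm" if "T0 \<le> s" "s \<le> tm" for s using mx[of xm s] p that by simp
    qed
    have "0 \<le> ?e * (sg * exp (- Lam ?r) * deriv (\<sigma> xm) tm + rate * (\<tau> tm - \<gamma>) * barrier ?r)"
      using 2 by simp
    also have "\<dots> = sg * deriv (\<sigma> xm) tm + ?e * (\<tau> tm - \<gamma>) * (rate * barrier ?r)"
      by (simp add: exp_minus field_simps)
    also have "\<dots> \<le> - (?e * \<tau> tm * ?r powr k * (N + k + br ?r * ?r)) + m1 + ?e * (\<tau> tm - \<gamma>) * (N * r0 powr k)"
      using 1 \<tau>_ge[of tm] rate_barrier_le[of ?r] r by (intro add_mono mult_left_mono) auto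
    finally have 3: "?e * \<tau> tm * ?r powr k * (N + k + br ?r * ?r) \<le> m1 + ?e * (\<tau> tm - \<gamma>) * (N * r0 powr k)"
      by linarith
    \<comment> \<open>The barrier dissipates at least \<open>\<tau> tm * N * r0 powr k\<close>, of
      which its own decay uses at most the share of \<open>\<tau> tm - \<gamma>\<close>. The share
      of \<open>\<gamma>\<close> is left, and it exceeds the forcing.\<close>
    have "?e * \<tau> tm * r0 powr k * N \<le> ?e * \<tau> tm * ?r powr k * (N + k + br ?r * ?r)"
    proof (intro mult_mono mult_left_mono)
      have "\<bar>br ?r * ?r\<bar> \<le> C2 * R"
        unfolding abs_mult using br_le[of ?r] r by (intro mult_mono) auto
      then show "N \<le> N + k + br ?r * ?r" by (simp add: k_def)
      show "r0 powr k \<le> ?r powr k" using r r0 k_nonneg by (intro powr_mono2) auto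
    qed (use \<tau>_ge[of tm] \<gamma>(1) N_pos in auto)
    with 3 have "?e * (\<gamma> * (N * r0 powr k)) \<le> m1" by (simp add: algebra_simps)
    moreover have "exp (- L) * (exp L * m1) < ?e * (\<gamma> * (N * r0 powr k))"
    proof -
      have "exp (- L) * (exp L * m1) < exp (- L) * (\<gamma> * (N * r0 powr k))" using \<gamma>(3) by simp
      also have "\<dots> \<le> ?e * (\<gamma> * (N * r0 powr k))"
        using L[of ?r] r \<gamma>(1) N_pos by (intro mult_right_mono) auto
      finally show ?thesis .
    qed
    ultimately show False by (simp add: mult.assoc[symmetric] mult_exp_exp)
  qed
  moreover have "Z x t \<le> Z xm tm" using mx x t closure_subset by blast
  ultimately have "Z x t \<le> 0" by linarith
  then show ?thesis by (simp add: Z_def \<tau>_def)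
qed

text \<open>Applying \<open>comparison\<close> with both signs bounds the absolute value. The
  heights \<open>\<alpha>\<close> and \<open>\<gamma>\<close> are linear in the data up to a
  vanishing slack; one factor \<open>exp L\<close> comes from passing to w, the other from returning
  to sigma.\<close>

lemma decay_estimate:
  "\<exists>C>0. \<forall>\<sigma> V T0 m0 m1 m2. solution \<sigma> V T0 \<and> 0 \<le> m0 \<and> 0 \<le> m1 \<and> 0 \<le> m2
      \<and> (\<forall>x\<in>U. \<bar>\<sigma> x T0\<bar> \<le> m0) \<and> (\<forall>x\<in>frontier U. \<forall>t>T0. \<bar>\<sigma> x t\<bar> \<le> m2)
      \<and> (\<forall>x\<in>U. \<forall>t>T0. norm (V x t) + norm (Vgrad V x t) \<le> m1)
    \<longrightarrow> (\<forall>x\<in>U. \<forall>t\<ge>T0. \<bar>\<sigma> x t\<bar> \<le> C * (exp (- rate * (t - T0)) * m0 + (m1 + m2)))"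
proof -
  from forcing_bound obtain M where M: "M \<ge> 0"
    and M2: "\<forall>x\<in>U. \<forall>V. (\<forall>i j. has_pd i (\<lambda>y. V y $ j) x) \<longrightarrow>
     \<bar>divg (\<lambda>y. Km y *v V y) x\<bar> \<le> M * (norm (V x) + norm (\<chi> j i. pd i (\<lambda>y. V y $ j) x))"
    by (elim exE conjE)
  have "bounded (Lam ` {r0..R})"
    by (intro compact_imp_bounded compact_continuous_image C1_on_imp_continuous_on C1_Lam compact_Icc)
  then obtain L where L: "\<And>r. r \<in> {r0..R} \<Longrightarrow> \<bar>Lam r\<bar> \<le> L"
    unfolding bounded_iff by (metis imageI real_norm_def)
  define hm where "hm = C0 * r0 powr (k + 2) / (k + 2)"
  define H where "H = C0 * R powr (k + 2) / (k + 2)"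
  have pos: "hm > 0" "H > 0" "N * r0 powr k > 0"
    using C0_pos k_nonneg r0 r0R N_pos by (auto simp: hm_def H_def)
  \<comment> \<open>The first quotient weighs initial and boundary values against the least value of
    the barrier, the second weighs the forcing against its least dissipation.\<close>
  define K where "K = 1 / hm + M / (N * r0 powr k)"
  have K: "K > 0" unfolding K_def using pos M by (intro add_pos_nonneg) auto
  show ?thesis
  proof (intro exI[of _ "exp L * H * (exp L * K)"] conjI allI impI ballI; (elim conjE)?)
    show "exp L * H * (exp L * K) > 0" using K pos by simp
    fix \<sigma> :: "real^'n \<Rightarrow> real \<Rightarrow> real" and V :: "real^'n \<Rightarrow> real \<Rightarrow> real^'n" and T0 m0 m1 m2 x t
    assume sol: "solution \<sigma> V T0" and m: "0 \<le> m0" "0 \<le> m1" "0 \<le> m2"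
      and init: "\<forall>x\<in>U. \<bar>\<sigma> x T0\<bar> \<le> m0" and bdry: "\<forall>x\<in>frontier U. \<forall>t>T0. \<bar>\<sigma> x t\<bar> \<le> m2"
      and Vb: "\<forall>x\<in>U. \<forall>t>T0. norm (V x t) + norm (Vgrad V x t) \<le> m1"
      and x: "x \<in> U" and t: "T0 \<le> t"
    have force: "\<bar>divg (\<lambda>y. Km y *v V y t) x\<bar> \<le> M * m1" if "x \<in> U" "t > T0" for x t
    proof -
      have "\<bar>divg (\<lambda>y. Km y *v V y t) x\<bar> \<le> M * (norm (V x t) + norm (Vgrad V x t))"
        using M2[rule_format, OF that(1), of "\<lambda>y. V y t"] that sol by (simp add: Vgrad_def solution_def)
      also have "\<dots> \<le> M * m1" using Vb that M by (intro mult_left_mono) auto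
      finally show ?thesis .
    qed
    let ?E = "exp (- rate * (t - T0))"
    define \<alpha> where "\<alpha> = exp L * m0 / hm"
    \<comment> \<open>The slack \<open>e\<close> supplies the strict inequality required by
      \<open>comparison\<close>; afterwards it tends to 0.\<close>
    define \<gamma> where "\<gamma> e = exp L * (M * m1) / (N * r0 powr k) + exp L * m2 / hm + e" for e
    have est: "\<bar>\<sigma> x t\<bar> \<le> exp L * H * (\<alpha> * ?E + \<gamma> e)" if e: "e > 0" for e
    proof -
      have \<alpha>0: "0 \<le> \<alpha>" using m pos by (simp add: \<alpha>_def)
      have \<gamma>0: "0 \<le> \<gamma> e" unfolding \<gamma>_def using m pos M e by (intro add_nonneg_nonneg) auto
      have a: "exp L * m0 \<le> \<alpha> * (C0 * r0 powr (k + 2) / (k + 2))"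
        unfolding hm_def[symmetric] \<alpha>_def using pos by simp
      have b: "exp L * m2 \<le> \<gamma> e * (C0 * r0 powr (k + 2) / (k + 2))"
      proof -
        have "exp L * m2 / hm \<le> \<gamma> e" unfolding \<gamma>_def using m pos M e by simp
        from mult_right_mono[OF this, of hm] show ?thesis unfolding hm_def[symmetric] using pos by simp
      qed
      have c: "exp L * (M * m1) < \<gamma> e * (N * r0 powr k)"
      proof -
        have "exp L * m2 / hm \<ge> 0" using m pos by simp
        then have "exp L * (M * m1) / (N * r0 powr k) < \<gamma> e" unfolding \<gamma>_def using e by linarith
        then show ?thesis using pos(3) by (simp only: pos_divide_less_eq)
      qed
      have "\<bar>exp (- Lam (norm x)) * \<sigma> x t\<bar> \<le> (\<alpha> * ?E + \<gamma> e) * barrier (norm x)"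
        using comparison[OF _ sol init[rule_format] bdry[rule_format] force L \<alpha>0 a \<gamma>0 b c x t, of 1]
          comparison[OF _ sol init[rule_format] bdry[rule_format] force L \<alpha>0 a \<gamma>0 b c x t, of "-1"]
        by (simp add: abs_le_iff)
      also have "\<dots> \<le> (\<alpha> * ?E + \<gamma> e) * H"
        unfolding H_def using barrier_bounds(2)[of "norm x"] norm_U'[OF x] \<alpha>0 \<gamma>0
        by (intro mult_left_mono) auto
      finally have *: "exp (- Lam (norm x)) * \<bar>\<sigma> x t\<bar> \<le> (\<alpha> * ?E + \<gamma> e) * H" by (simp add: abs_mult)
      have "\<bar>\<sigma> x t\<bar> = exp (Lam (norm x)) * (exp (- Lam (norm x)) * \<bar>\<sigma> x t\<bar>)" by (simp add: exp_minus)
      also have "\<dots> \<le> exp L * ((\<alpha> * ?E + \<gamma> e) * H)"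
        by (rule mult_mono[OF _ *]) (use L[of "norm x"] norm_U'[OF x] in auto)
      finally show ?thesis by (simp add: mult_ac)
    qed
    have "\<bar>\<sigma> x t\<bar> \<le> exp L * H * (\<alpha> * ?E + \<gamma> 0)"
    proof (rule field_le_epsilon)
      fix e :: real assume "e > 0"
      then show "\<bar>\<sigma> x t\<bar> \<le> exp L * H * (\<alpha> * ?E + \<gamma> 0) + e"
        using est[of "e / (exp L * H)"] pos by (simp add: \<gamma>_def distrib_left)
    qed
    also have "\<alpha> * ?E + \<gamma> 0 \<le> exp L * K * (?E * m0 + (m1 + m2))"
    proof -
      have "K \<ge> 1 / hm" "K \<ge> M / (N * r0 powr k)" using pos M by (auto simp: K_def)
      then have "1 / hm * (?E * m0) + M / (N * r0 powr k) * m1 + 1 / hm * m2 \<le> K * (?E * m0) + K * m1 + K * m2"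
        using m by (intro add_mono mult_right_mono) auto
      from mult_left_mono[OF this, of "exp L"] show ?thesis
        by (simp add: \<alpha>_def \<gamma>_def algebra_simps)
    qed
    finally show "\<bar>\<sigma> x t\<bar> \<le> exp L * H * (exp L * K) * (?E * m0 + (m1 + m2))"
      using pos by (simp add: mult.assoc)
  qed
qed

end

section \<open>Restarting the estimate and the long-time limit\<close>

context radial_diffusion begin

lemma solution_restart:
  assumes "solution \<sigma> V T0" "T0 \<le> T" shows "solution \<sigma> V T"
proof -
  note sol = assms(1)[unfolded solution_def]
  note c2 = conjunct2[OF sol]
  note c3 = conjunct2[OF c2]
  note c4 = conjunct2[OF c3]
  have "T0 < t" if "T < t" for t using that assms(2) by linarith
  then show ?thesis unfolding solution_def
    by (intro conjI ballI allI impI conjunct1[OF c2] conjunct1[OF c3] order_trans[OF conjunct1[OF sol] assms(2)]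
        conjunct1[OF c4, rule_format] conjunct2[OF c4, rule_format])
qed

text \<open>Without boundary points the supremum of |g| would be over the empty set, hence of
  unspecified value. In a connected space only the empty set and the whole space have empty
  frontier, and \<open>U\<close> misses 0.\<close>

lemma frontier_nonempty: "U \<noteq> {} \<Longrightarrow> frontier U \<noteq> {}"
proof -
  assume "U \<noteq> {}"
  moreover have "0 \<notin> U" using norm_U'[of 0] by auto
  ultimately show ?thesis unfolding frontier_eq_empty by blast
qed

lemma bdd_above_slice:
  fixes \<sigma> :: "real^'n \<Rightarrow> real"
  assumes "continuous_on (closure U) \<sigma>" shows "bdd_above ((\<lambda>x. \<bar>\<sigma> x\<bar>) ` U)"
proof -
  have "bdd_above ((\<lambda>x. \<bar>\<sigma> x\<bar>) ` closure U)"
    by (intro bounded_imp_bdd_above compact_imp_bounded compact_continuous_image compact_closure_U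
        continuous_intros assms)
  then show ?thesis by (rule bdd_above_mono) (use closure_subset[of U] in auto)
qed

text \<open>The factor 2 in the constant comes from bounding each of \<open>V\<close> and \<open>g\<close> by the limsup of their sum.\<close>
lemma stability:
  assumes ne: "U \<noteq> {}" and eta: "eta \<le> rate"
  shows "\<exists>C>0. \<forall>\<sigma>0 g V \<sigma>. continuous_on (closure U) \<sigma>0
   \<and> bdd_above {norm (V x t) + norm (Vgrad V x t) | x t. x \<in> U \<and> t > 0}
   \<and> bdd_above {\<bar>g x t\<bar> | x t. x \<in> frontier U \<and> t \<ge> 0}
   \<and> solution \<sigma> V 0
   \<and> (\<forall>x\<in>frontier U. \<forall>t>0. \<sigma> x t = g x t)
   \<and> (\<forall>x\<in>U. \<sigma> x 0 = \<sigma>0 x)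
   \<longrightarrow>
     (\<forall>t>0. Sup ((\<lambda>x. \<bar>\<sigma> x t\<bar>) ` U) \<le>
        C * (exp (- eta * t) * Sup ((\<lambda>x. \<bar>\<sigma>0 x\<bar>) ` U)
             + (Sup {norm (V x t) + norm (Vgrad V x t) | x t. x \<in> U \<and> t > 0}
                + Sup {\<bar>g x t\<bar> | x t. x \<in> frontier U \<and> t \<ge> 0})))
   \<and> Limsup at_top (\<lambda>t. ereal (Sup ((\<lambda>x. \<bar>\<sigma> x t\<bar>) ` U)))
       \<le> ereal C * Limsup at_top (\<lambda>t. ereal (Sup ((\<lambda>x. norm (V x t) + norm (Vgrad V x t)) ` U)
                                             + Sup ((\<lambda>x. \<bar>g x t\<bar>) ` frontier U)))"
proof -
  from decay_estimate obtain C where C: "C > 0"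
    and est: "\<forall>\<sigma> V T0 m0 m1 m2. solution \<sigma> V T0 \<and> 0 \<le> m0 \<and> 0 \<le> m1 \<and> 0 \<le> m2
      \<and> (\<forall>x\<in>U. \<bar>\<sigma> x T0\<bar> \<le> m0) \<and> (\<forall>x\<in>frontier U. \<forall>t>T0. \<bar>\<sigma> x t\<bar> \<le> m2)
      \<and> (\<forall>x\<in>U. \<forall>t>T0. norm (V x t) + norm (Vgrad V x t) \<le> m1)
    \<longrightarrow> (\<forall>x\<in>U. \<forall>t\<ge>T0. \<bar>\<sigma> x t\<bar> \<le> C * (exp (- rate * (t - T0)) * m0 + (m1 + m2)))"
    by (elim exE conjE)
  obtain xU where xU: "xU \<in> U" using ne by auto
  obtain xF where xF: "xF \<in> frontier U" using frontier_nonempty[OF ne] by auto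
  show ?thesis
  proof (intro exI[of _ "2 * C"] conjI allI impI; (elim conjE)?)
    show "2 * C > 0" using C by simp
  next
    fix \<sigma>0 :: "real^'n \<Rightarrow> real" and g :: "real^'n \<Rightarrow> real \<Rightarrow> real" and V :: "real^'n \<Rightarrow> real \<Rightarrow> real^'n"
      and \<sigma> :: "real^'n \<Rightarrow> real \<Rightarrow> real" and t :: real
    let ?SV = "{norm (V x t) + norm (Vgrad V x t) | x t. x \<in> U \<and> t > 0}"
    let ?Sg = "{\<bar>g x t\<bar> | x t. x \<in> frontier U \<and> t \<ge> 0}"
    assume cont0: "continuous_on (closure U) \<sigma>0" and bV: "bdd_above ?SV" and bg: "bdd_above ?Sg"
      and sol: "solution \<sigma> V 0" and bdry: "\<forall>x\<in>frontier U. \<forall>t>0. \<sigma> x t = g x t"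
      and init: "\<forall>x\<in>U. \<sigma> x 0 = \<sigma>0 x" and t: "0 < t"
    note b0 = bdd_above_slice[OF cont0]
    let ?m0 = "Sup ((\<lambda>x. \<bar>\<sigma>0 x\<bar>) ` U)"
    have m0: "\<bar>\<sigma>0 x\<bar> \<le> ?m0" if "x \<in> U" for x by (rule cSUP_upper[OF that b0])
    have m1: "norm (V x t) + norm (Vgrad V x t) \<le> Sup ?SV" if "x \<in> U" "t > 0" for x t
      by (rule cSup_upper[OF _ bV]) (use that in blast)
    have m2: "\<bar>g x t\<bar> \<le> Sup ?Sg" if "x \<in> frontier U" "t \<ge> 0" for x t
      by (rule cSup_upper[OF _ bg]) (use that in blast)
    have nn: "0 \<le> ?m0" "0 \<le> Sup ?SV" "0 \<le> Sup ?Sg"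
      using order_trans[OF abs_ge_zero m0[OF xU]] order_trans[OF add_nonneg_nonneg[OF norm_ge_zero norm_ge_zero] m1[OF xU t]]
        order_trans[OF abs_ge_zero m2[OF xF order_refl]] by simp_all
    have ball: "\<bar>\<sigma> x t\<bar> \<le> C * (exp (- rate * (t - 0)) * ?m0 + (Sup ?SV + Sup ?Sg))" if "x \<in> U" for x
      using est[rule_format, of \<sigma> V 0 ?m0 "Sup ?SV" "Sup ?Sg" x t] sol nn init m0 bdry m1 m2 t that by auto
    show "Sup ((\<lambda>x. \<bar>\<sigma> x t\<bar>) ` U) \<le> 2 * C * (exp (- eta * t) * ?m0 + (Sup ?SV + Sup ?Sg))"
    proof (rule cSUP_least[OF ne])
      fix x assume "x \<in> U"
      from ball[OF this] have "\<bar>\<sigma> x t\<bar> \<le> C * (exp (- rate * t) * ?m0 + (Sup ?SV + Sup ?Sg))" by simp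
      also have "\<dots> \<le> C * (exp (- eta * t) * ?m0 + (Sup ?SV + Sup ?Sg))"
        using C nn t eta by (intro mult_left_mono add_right_mono mult_right_mono) auto
      also have "\<dots> \<le> 2 * C * (exp (- eta * t) * ?m0 + (Sup ?SV + Sup ?Sg))"
        using C nn by (intro mult_right_mono) auto
      finally show "\<bar>\<sigma> x t\<bar> \<le> 2 * C * (exp (- eta * t) * ?m0 + (Sup ?SV + Sup ?Sg))" .
    qed
  next
    fix \<sigma>0 :: "real^'n \<Rightarrow> real" and g :: "real^'n \<Rightarrow> real \<Rightarrow> real" and V :: "real^'n \<Rightarrow> real \<Rightarrow> real^'n"
      and \<sigma> :: "real^'n \<Rightarrow> real \<Rightarrow> real"
    let ?SV = "{norm (V x t) + norm (Vgrad V x t) | x t. x \<in> U \<and> t > 0}"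
    let ?Sg = "{\<bar>g x t\<bar> | x t. x \<in> frontier U \<and> t \<ge> 0}"
    assume cont0: "continuous_on (closure U) \<sigma>0" and bV: "bdd_above ?SV" and bg: "bdd_above ?Sg"
      and sol: "solution \<sigma> V 0" and bdry: "\<forall>x\<in>frontier U. \<forall>t>0. \<sigma> x t = g x t"
      and init: "\<forall>x\<in>U. \<sigma> x 0 = \<sigma>0 x"
    define v where "v t = Sup ((\<lambda>x. norm (V x t) + norm (Vgrad V x t)) ` U)" for t
    define w where "w t = Sup ((\<lambda>x. \<bar>g x t\<bar>) ` frontier U)" for t
    define S where "S t = Sup ((\<lambda>x. \<bar>\<sigma> x t\<bar>) ` U)" for t
    have v: "norm (V x t) + norm (Vgrad V x t) \<le> v t" if "x \<in> U" "t > 0" for x t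
      unfolding v_def by (rule cSUP_upper[OF that(1)], rule bdd_above_mono[OF bV]) (use that in blast)
    have w: "\<bar>g x t\<bar> \<le> w t" if "x \<in> frontier U" "t > 0" for x t
      unfolding w_def by (rule cSUP_upper[OF that(1)], rule bdd_above_mono[OF bg]) (use that less_imp_le in blast)
    have v0: "0 \<le> v t" and w0: "0 \<le> w t" if "t > 0" for t
      using order_trans[OF add_nonneg_nonneg[OF norm_ge_zero norm_ge_zero] v[OF xU that]]
        order_trans[OF abs_ge_zero w[OF xF that]] by simp_all
    have v1: "v t \<le> Sup ?SV" if "t > 0" for t
      unfolding v_def by (rule cSUP_least[OF ne], rule cSup_upper[OF _ bV]) (use that in blast)
    have w1: "w t \<le> Sup ?Sg" if "t > 0" for t
      unfolding w_def by (rule cSUP_least[OF frontier_nonempty[OF ne]], rule cSup_upper[OF _ bg]) (use that less_imp_le in blast)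
    let ?l = "Limsup at_top (\<lambda>t. ereal (v t + w t))"
    have "?l \<le> ereal (Sup ?SV + Sup ?Sg)"
      by (rule Limsup_bounded, rule eventually_mono[OF eventually_gt_at_top[of 0]]) (simp add: v1 w1 add_mono)
    moreover have "0 \<le> ?l"
      by (rule le_Limsup, simp, rule eventually_mono[OF eventually_gt_at_top[of 0]]) (use v0 w0 in simp)
    \<comment> \<open>Nonnegativity and the global bounds make the limsup a real number, so the rest
      can be computed in the reals.\<close>
    ultimately obtain l where l: "?l = ereal l" "0 \<le> l" by (cases ?l) auto
    have "Limsup at_top (\<lambda>t. ereal (S t)) \<le> ereal (2 * C * l) + ereal e" if e: "e > 0" for e
    proof -
      \<comment> \<open>\<open>d\<close> is the excess over the limsup that becomes \<open>e\<close>
        after multiplication by the constant \<open>2 * C\<close>.\<close>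
      define d where "d = e / (2 * C)"
      have d: "d > 0" "2 * C * (l + d) = 2 * C * l + e" using e C by (auto simp: d_def distrib_left)
      have "?l < ereal (l + d)" using l d by simp
      from Limsup_lessD[OF this] obtain T where "\<forall>t\<ge>T. v t + w t < l + d"
        unfolding eventually_at_top_linorder by auto
      then obtain T0 where T0: "T0 > 0" "\<And>t. t \<ge> T0 \<Longrightarrow> v t + w t < l + d"
        by (metis gt_ex max.bounded_iff max.strict_coboundedI1 max_def less_le_trans)
      have sol': "solution \<sigma> V T0" by (rule solution_restart[OF sol]) (use T0 in simp)
      have "continuous_on (closure U) (\<lambda>x. \<sigma> x T0)"
        using continuous_on_slice[of "closure U" "{0..}" \<sigma> T0] sol T0(1) by (simp add: solution_def)
      note b = bdd_above_slice[OF this]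
      have m0: "\<bar>\<sigma> x T0\<bar> \<le> S T0" if "x \<in> U" for x unfolding S_def by (rule cSUP_upper[OF that b])
      have m0': "0 \<le> S T0" using order_trans[OF abs_ge_zero m0[OF xU]] .
      have vb: "norm (V x t) + norm (Vgrad V x t) \<le> l + d" if "x \<in> U" "t > T0" for x t
        using v[of x t] w0[of t] T0(2)[of t] T0(1) that by simp
      have wb: "\<bar>\<sigma> x t\<bar> \<le> l + d" if "x \<in> frontier U" "t > T0" for x t
        using w[of x t] v0[of t] T0(2)[of t] T0(1) that bdry by simp
      have "S t \<le> C * (exp (- rate * (t - T0)) * S T0 + (l + d + (l + d)))" if t: "t \<ge> T0" for t
        unfolding S_def[of t]
        by (rule cSUP_least[OF ne], rule est[rule_format])
           (use sol' m0 m0' vb wb l(2) d(1) t in auto)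
      then have "Limsup at_top (\<lambda>t. ereal (S t)) \<le>
          Limsup at_top (\<lambda>t. ereal (C * (exp (- rate * (t - T0)) * S T0 + (l + d + (l + d)))))"
        by (intro Limsup_mono eventually_mono[OF eventually_ge_at_top[of T0]]) simp
      also have "\<dots> = ereal (C * (0 * S T0 + (l + d + (l + d))))"
      proof (intro lim_imp_Limsup tendsto_ereal tendsto_intros)
        have "filterlim (\<lambda>t. rate * (- T0 + t)) at_top at_top"
          by (intro filterlim_tendsto_pos_mult_at_top[OF tendsto_const rate_pos]
              filterlim_tendsto_add_at_top[OF tendsto_const] filterlim_ident)
        then have "filterlim (\<lambda>t. - rate * (t - T0)) at_bot at_top"
          by (simp add: filterlim_uminus_at_top algebra_simps)
        then show "((\<lambda>t. exp (- rate * (t - T0))) \<longlongrightarrow> 0) at_top" by (rule filterlim_compose[OF exp_at_bot])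
      qed simp
      also have "\<dots> = ereal (2 * C * l) + ereal e" using d(2) by (simp add: algebra_simps)
      finally show ?thesis .
    qed
    then have "Limsup at_top (\<lambda>t. ereal (S t)) \<le> ereal (2 * C * l)" using ereal_le_epsilon2 by blast
    also have "\<dots> = ereal (2 * C) * ?l" unfolding l(1) by simp
    finally show "Limsup at_top (\<lambda>t. ereal (Sup ((\<lambda>x. \<bar>\<sigma> x t\<bar>) ` U)))
       \<le> ereal (2 * C) * Limsup at_top (\<lambda>t. ereal (Sup ((\<lambda>x. norm (V x t) + norm (Vgrad V x t)) ` U)
                                             + Sup ((\<lambda>x. \<bar>g x t\<bar>) ` frontier U)))"
      unfolding S_def v_def w_def .
  qed
qed

end

section \<open>The Forchheimer coefficients\<close>

text \<open>\<open>\<gamma> z\<close> is \<open>z g'(z)\<close>, which unlike \<open>deriv g\<close> is meaningful at \<open>z = 0\<close>.\<close>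
lemma admissible_gE:
  assumes "admissible_g g"
  obtains \<gamma> where "0 < g 0" "\<gamma> 0 = 0" "\<And>z. 0 \<le> z \<Longrightarrow> 0 \<le> \<gamma> z"
    "\<And>z w. 0 \<le> z \<Longrightarrow> z \<le> w \<Longrightarrow> g z \<le> g w" "\<And>z w. 0 \<le> z \<Longrightarrow> z \<le> w \<Longrightarrow> \<gamma> z \<le> \<gamma> w"
    "\<And>z. 0 < z \<Longrightarrow> deriv g z * z = \<gamma> z"
    "\<And>S f. C1_on S f \<Longrightarrow> (\<And>x. x \<in> S \<Longrightarrow> 0 < f x) \<Longrightarrow> C1_on S (\<lambda>x. g (f x))"
    "\<And>S f. C1_on S f \<Longrightarrow> (\<And>x. x \<in> S \<Longrightarrow> 0 < f x) \<Longrightarrow> C1_on S (\<lambda>x. \<gamma> (f x))"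
proof -
  obtain a0 a al N where a0: "a0 > 0" and pos: "\<And>j. j < N \<Longrightarrow> a j \<ge> 0 \<and> al j > 0"
    and g: "\<And>s. s \<ge> 0 \<Longrightarrow> g s = a0 + (\<Sum>j<(N::nat). a j * s powr al j)"
    using assms unfolding admissible_g_def gfun_def by metis
  define \<gamma> where "\<gamma> z = (\<Sum>j<N. a j * al j * z powr al j)" for z
  show ?thesis
  proof (rule that[of \<gamma>])
    show "0 < g 0" using a0 by (simp add: g)
    show "\<gamma> 0 = 0" by (simp add: \<gamma>_def)
    show "0 \<le> \<gamma> z" if "0 \<le> z" for z
      unfolding \<gamma>_def using pos by (intro sum_nonneg mult_nonneg_nonneg) (auto intro: less_imp_le)
    show "g z \<le> g w" if "0 \<le> z" "z \<le> w" for z w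
      using that pos by (auto simp: g intro!: sum_mono mult_left_mono powr_mono2 intro: less_imp_le)
    show "\<gamma> z \<le> \<gamma> w" if "0 \<le> z" "z \<le> w" for z w
      using that pos by (auto simp: \<gamma>_def intro!: sum_mono mult_left_mono powr_mono2 mult_nonneg_nonneg intro: less_imp_le)
    show "deriv g z * z = \<gamma> z" if z: "0 < z" for z
    proof -
      have "((\<lambda>s. a0 + (\<Sum>j<N. a j * s powr al j)) has_real_derivative 0 + (\<Sum>j<N. a j * (al j * z powr (al j - 1)))) (at z)"
        by (intro DERIV_add DERIV_const DERIV_sum DERIV_cmult has_real_derivative_powr z)
      then have "(g has_real_derivative 0 + (\<Sum>j<N. a j * (al j * z powr (al j - 1)))) (at z)"
        by (rule has_field_derivative_transform_within_open[of _ _ _ "{0<..}"]) (use z in \<open>auto simp: g\<close>)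
      then have "deriv g z * z = (\<Sum>j<N. a j * (al j * z powr (al j - 1)) * z)"
        by (simp add: DERIV_imp_deriv sum_distrib_right)
      also have "\<dots> = \<gamma> z" unfolding \<gamma>_def using z by (intro sum.cong) (simp_all add: powr_diff)
      finally show ?thesis .
    qed
    show "C1_on S (\<lambda>x. \<gamma> (f x))" if "C1_on S f" "\<And>x. x \<in> S \<Longrightarrow> 0 < f x" for S f
      unfolding \<gamma>_def by (intro C1_on_sum C1_on_mult C1_on_const C1_on_powr that)
    show "C1_on S (\<lambda>x. g (f x))" if f: "C1_on S f" "\<And>x. x \<in> S \<Longrightarrow> 0 < f x" for S f
    proof (rule C1_on_cong)
      show "C1_on S (\<lambda>x. a0 + (\<Sum>j<N. a j * f x powr al j))"
        by (intro C1_on_add C1_on_sum C1_on_mult C1_on_const C1_on_powr f)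
      show "a0 + (\<Sum>j<N. a j * f x powr al j) = g (f x)" if "x \<in> S" for x
        using f(2)[OF that] by (simp add: g)
    qed
  qed
qed

lemma ustar_eq: "x \<noteq> 0 \<Longrightarrow> ustar c x = (c * norm x powr (1 - real CARD('n)) / norm x) *\<^sub>R x"
  for x :: "real^'n"
  unfolding ustar_def by (simp add: powr_diff powr_realpow)

lemma norm_ustar: "x \<noteq> 0 \<Longrightarrow> norm (ustar c x) = \<bar>c\<bar> * norm x powr (1 - real CARD('n))"
  for x :: "real^'n"
  by (simp add: ustar_eq abs_mult)

text \<open>For nonzero c, u u^T = z^2 x x^T / |x|^2 turns the coefficient g'(z)/z into
  \<open>\<gamma> z / (norm x)\<^sup>2\<close>. For c = 0 the default branch of \<open>Gjac\<close>
  agrees with this because \<open>\<gamma> 0 = 0\<close>.\<close>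

lemma Gjac_ustar:
  fixes x :: "real^'n" and c :: real
  assumes x: "x \<noteq> 0" and \<gamma>: "\<gamma> 0 = 0" "\<And>z. 0 < z \<Longrightarrow> deriv g z * z = \<gamma> z"
  defines "z \<equiv> \<bar>c\<bar> * norm x powr (1 - real CARD('n))"
  shows "Gjac g (ustar c x) = rmat (g z) (\<gamma> z / (norm x)\<^sup>2) x"
proof (cases "c = 0")
  case True
  then show ?thesis using \<gamma> by (simp add: Gjac_def ustar_def z_def rmat_def mat_def vec_eq_iff)
next
  case False
  let ?q = "c * norm x powr (1 - real CARD('n)) / norm x"
  have z: "z > 0" "norm (ustar c x) = z" "ustar c x \<noteq> 0"
    using False x norm_ustar[OF x, of c] by (auto simp: z_def)
  have "(deriv g z / z) * (?q * ?q) = \<gamma> z / (norm x)\<^sup>2"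
  proof -
    have "?q * ?q = z * z / (norm x)\<^sup>2" by (simp add: z_def power2_eq_square)
    then show ?thesis using \<gamma>(2)[OF z(1)] z(1) by (simp add: field_simps)
  qed
  moreover have "(deriv g z / z) * (?q * a * (?q * b)) = (deriv g z / z) * (?q * ?q) * a * b" for a b
    by (simp only: mult_ac)
  ultimately have "(deriv g z / z) * (?q * a * (?q * b)) = \<gamma> z / (norm x)\<^sup>2 * a * b" for a b
    by (simp only:)
  then have "deriv g z / z * (ustar c x $ i * ustar c x $ j) = \<gamma> z / (norm x)\<^sup>2 * x $ i * x $ j" for i j
    unfolding ustar_eq[OF x] by simp
  moreover have "Gjac g (ustar c x) = g z *\<^sub>R mat 1 + (deriv g z / z) *\<^sub>R outer (ustar c x) (ustar c x)"
    using z(3) by (simp add: Gjac_def z(2))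
  ultimately show ?thesis
    by (simp add: rmat_def outer_def mat_def vec_eq_iff)
qed

section \<open>Regularity, signs and ranges of the coefficient functions, and the two decay
  rates\<close>

lemma Ck_on_derivs:
  assumes "Ck_on k S F" "j < k" "x \<in> S"
  shows "((deriv ^^ j) F has_real_derivative (deriv ^^ Suc j) F x) (at x)"
  using assms unfolding Ck_on_def by (auto simp: DERIV_deriv_iff_field_differentiable less_imp_le)

lemma C1_on_Ck_compose:
  assumes "Ck_on k T F" "j < k" "C1_on S f" "\<And>x. x \<in> S \<Longrightarrow> f x \<in> T"
  shows "C1_on S (\<lambda>x. (deriv ^^ j) F (f x))"
  by (rule C1_on_compose[OF assms(3,4), where F' = "(deriv ^^ Suc j) F"])
     (use assms(1,2) Ck_on_derivs[OF assms(1,2)] in \<open>auto simp: Ck_on_def Suc_le_eq simp del: funpow.simps\<close>)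

text \<open>The mean value theorem on \<open>{0..s}\<close> for \<open>f1\<close> and on
  \<open>{s..1}\<close> for \<open>f2\<close>; this is the source of the positivity of
  \<open>F1\<close> and \<open>F2\<close>.\<close>

lemma positive_of_zero_at_endpoint:
  assumes "continuous_on {0..1} f1" "Ck_on 1 {0<..<1} f1" "continuous_on {0..1} f2" "Ck_on 1 {0<..<1} f2"
    and "f1 0 = 0" "f2 1 = 0" "\<forall>s\<in>{0<..<1}. deriv f1 s > 0 \<and> deriv f2 s < 0"
    and s: "s \<in> {0<..<1}"
  shows "0 < f1 s" "0 < f2 s"
proof -
  have d: "f1 differentiable (at x)" "f2 differentiable (at x)" if "x \<in> {0<..<1}" for x
    using Ck_on_derivs[OF assms(2), of 0 x] Ck_on_derivs[OF assms(4), of 0 x] that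
    by (auto simp: real_differentiable_def)
  have D: "D = deriv f1 x" if "(f1 has_real_derivative D) (at x)" for D x
    using that by (simp add: DERIV_imp_deriv)
  obtain l z where z: "0 < z" "z < s" "(f1 has_real_derivative l) (at z)" "f1 s - f1 0 = (s - 0) * l"
    using MVT[of 0 s f1] d(1) s continuous_on_subset[OF assms(1), of "{0..s}"] by auto
  then have "l > 0" using assms(7) D[OF z(3)] s by auto
  then show "0 < f1 s" using z s assms(5) by simp
  obtain l z where z: "s < z" "z < 1" "(f2 has_real_derivative l) (at z)" "f2 1 - f2 s = (1 - s) * l"
    using MVT[of s 1 f2] d(2) s continuous_on_subset[OF assms(3), of "{s..1}"] by auto
  then have "l < 0" using assms(7) DERIV_imp_deriv[OF z(3)] s by auto
  then have "(1 - s) * l < 0" using s by (simp add: mult_pos_neg)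
  then show "0 < f2 s" using z assms(6) by simp
qed

text \<open>Compactness makes the suprema and infima in \<open>eta1\<close> finite, and the infimum
  is attained, hence positive. These facts link values at \<open>Shat r\<close> with the
  constants.\<close>

lemma C1_range_bounds:
  assumes F: "Ck_on k {0<..<1} F" "1 \<le> k" "\<forall>s\<in>{0<..<1}. 0 < F s"
    and s: "0 < a" "b < 1" "s \<in> {a..b}"
  shows "F s \<le> Sup (F ` {a..b})" "Inf (F ` {a..b}) \<le> F s" "0 < Inf (F ` {a..b})"
    "\<bar>deriv F s\<bar> \<le> Sup ((\<lambda>s. \<bar>deriv F s\<bar>) ` {a..b})"
proof -
  have sub: "{a..b} \<subseteq> {0<..<1}" using s by auto
  have "continuous_on {0<..<1} ((deriv ^^ 0) F)" "continuous_on {0<..<1} ((deriv ^^ 1) F)"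
    using F(1,2) unfolding Ck_on_def by blast+
  then have c: "continuous_on {a..b} F" "continuous_on {a..b} (\<lambda>s. \<bar>deriv F s\<bar>)"
    using continuous_on_subset[OF _ sub] by (auto intro!: continuous_intros)
  then have bd: "bounded (F ` {a..b})" "bounded ((\<lambda>s. \<bar>deriv F s\<bar>) ` {a..b})"
    by (auto intro!: compact_imp_bounded compact_continuous_image)
  show "F s \<le> Sup (F ` {a..b})" "\<bar>deriv F s\<bar> \<le> Sup ((\<lambda>s. \<bar>deriv F s\<bar>) ` {a..b})"
    by (intro cSUP_upper s bounded_imp_bdd_above bd)+
  show "Inf (F ` {a..b}) \<le> F s" by (intro cINF_lower s bounded_imp_bdd_below bd)
  obtain m where m: "m \<in> {a..b}" "\<And>y. y \<in> {a..b} \<Longrightarrow> F m \<le> F y"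
    using continuous_attains_inf[OF compact_Icc _ c(1)] s(3) by (metis empty_iff)
  have "0 < F m" using F(3) m(1) sub by blast
  also have "F m \<le> Inf (F ` {a..b})" using m s(3) by (intro cINF_greatest) auto
  finally show "0 < Inf (F ` {a..b})" .
qed

text \<open>Put k = C2 R. From C1 <= C0 follows \<open>k0\<close> >= 1/2, so 2 \<open>sR\<close> >=
  n + k >= k; together with ln(1 + x) <= x and r0/R < 1 this bounds the numerator by (r0/R)^k. In
  the denominator \<open>k0\<close> cancels, and n >= 2 gives 2 (n + k) <= n (k + 2). The right-hand
  side is \<open>rate\<close>.\<close>

lemma decay_rate_comparison:
  fixes n r0 R C0 C1 C2 :: real
  assumes n: "n \<ge> 2" and r: "0 < r0" "r0 < R" and C: "0 < C1" "C1 \<le> C0" "0 \<le> C2"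
  defines "k0 \<equiv> C0 / (2 * C1)"
  defines "sR \<equiv> k0 * (n + C2 * R)"
  shows "ln (1 + (r0 / R) powr (2 * sR)) / (k0 * C0 / (2 * sR) * R\<^sup>2)
     \<le> n * (C2 * R + 2) * r0 powr (C2 * R) / (C0 * R powr (C2 * R + 2))"
proof -
  define k where "k = C2 * R"
  have k: "k \<ge> 0" using r C by (simp add: k_def)
  have k0: "k0 \<ge> 1 / 2" "k0 > 0" using C by (auto simp: k0_def field_simps)
  have "(1 / 2) * (n + k) \<le> sR" unfolding sR_def k_def[symmetric] using k0 k n by (intro mult_right_mono) auto
  then have sR: "2 * sR \<ge> k" "sR > 0" using k n by auto
  have den: "k0 * C0 / (2 * sR) * R\<^sup>2 = C0 * R\<^sup>2 / (2 * (n + k))"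
    using k0 by (simp add: sR_def k_def)
  have "ln (1 + (r0 / R) powr (2 * sR)) \<le> (r0 / R) powr (2 * sR)"
    by (rule ln_add_one_self_le_self) simp
  also have "\<dots> \<le> (r0 / R) powr k" using sR r by (intro powr_mono') auto
  finally have "ln (1 + (r0 / R) powr (2 * sR)) / (C0 * R\<^sup>2 / (2 * (n + k))) \<le> (r0 / R) powr k / (C0 * R\<^sup>2 / (2 * (n + k)))"
    using C k n by (intro divide_right_mono) auto
  also have "\<dots> = (2 * (n + k)) * ((r0 / R) powr k / (C0 * R\<^sup>2))" by simp
  also have "\<dots> \<le> (n * (k + 2)) * ((r0 / R) powr k / (C0 * R\<^sup>2))"
  proof (rule mult_right_mono)
    have "2 * k \<le> n * k" using n k by (intro mult_right_mono)
    then show "2 * (n + k) \<le> n * (k + 2)" by (simp add: algebra_simps)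
  qed (use C in auto)
  also have "\<dots> = n * (k + 2) * r0 powr k / (C0 * R powr (k + 2))"
    using r C by (simp add: powr_divide powr_add powr_realpow[of R 2, simplified] field_simps)
  finally show ?thesis unfolding den k_def .
qed

lemma divg_cong_open:
  assumes "open U" "x \<in> U" "\<And>y. y \<in> U \<Longrightarrow> W y = W' y"
  shows "divg W x = divg W' x"
  unfolding divg_def by (intro sum.cong refl pd_cong_open[OF assms(1,2)]) (simp add: assms(3))

lemma rmat_scale: "c *\<^sub>R rmat a b x = rmat (c * a) (c * b) x"
  by (auto simp: rmat_def vec_eq_iff algebra_simps)

lemma rmat_add: "rmat a b x + rmat a' b' x = rmat (a + a') (b + b') x"
  by (auto simp: rmat_def vec_eq_iff algebra_simps)

text \<open>It carries the constant of \<open>stability\<close> over to the theorem: the hypotheses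
  on the data are converted while the estimates themselves remain untouched.\<close>

lemma ex_pos_all_weaken:
  assumes "\<exists>C>0. \<forall>a b c d. P a b c d \<longrightarrow> Q C a b c d" "\<And>a b c d. P' a b c d \<Longrightarrow> P a b c d"
  shows "\<exists>C>(0::real). \<forall>a b c d. P' a b c d \<longrightarrow> Q C a b c d"
  using assms by blast

theorem theorem4p8:
  fixes g1 g2 f1 f2 pcd Shat :: "real \<Rightarrow> real"
    and r0 c1 c2 s0 R sl sh :: real
    and U :: "(real^'n) set"
  defines "F1 \<equiv> Fq pcd f1" and "F2 \<equiv> Fq pcd f2"
  assumes n2: "CARD('n) \<ge> 2"
    and g1: "admissible_g g1" and g2: "admissible_g g2"
    and f1c: "continuous_on {0..1} f1" "Ck_on 1 {0<..<1} f1"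
    and f2c: "continuous_on {0..1} f2" "Ck_on 1 {0<..<1} f2"
    and f0: "f1 0 = 0" "f2 1 = 0"
    and fmono: "\<forall>s\<in>{0<..<1}. deriv f1 s > 0 \<and> deriv f2 s < 0"
    and pc: "Ck_on 1 {0<..<1} pcd" "\<forall>s\<in>{0<..<1}. pcd s > 0"
    and r0: "r0 > 0" and cc: "c1\<^sup>2 + c2\<^sup>2 > 0" and s0: "0 < s0" "s0 < 1"
    and ode: "\<forall>r\<in>{r0..R}. (Shat has_real_derivative
                 (Gs g2 (c2 * r powr (1 - real CARD('n))) * F2 (Shat r)
                  - Gs g1 (c1 * r powr (1 - real CARD('n))) * F1 (Shat r))) (at r within {r0..R})"
    and Sinit: "Shat r0 = s0"
    and R: "r0 < R"
    and sbounds: "0 < sl" "sh < 1" "\<forall>r\<in>{r0..R}. sl \<le> Shat r \<and> Shat r \<le> sh"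
    and U: "open U" "bounded U" "U \<noteq> {}" "U \<subseteq> ball 0 R - cball 0 r0"
    and E1F: "Ck_on 7 {0<..<1} F1" "Ck_on 7 {0<..<1} F2"
  shows "\<exists>C>0. \<forall>(\<sigma>0 :: real^'n \<Rightarrow> real) (g :: real^'n \<Rightarrow> real \<Rightarrow> real)
                 (V :: real^'n \<Rightarrow> real \<Rightarrow> real^'n) (\<sigma> :: real^'n \<Rightarrow> real \<Rightarrow> real).
     continuous_on (closure U) \<sigma>0
   \<and> continuous_on (frontier U \<times> {0..}) (\<lambda>(x,t). g x t)
   \<and> (\<forall>x\<in>frontier U. \<sigma>0 x = g x 0)
   \<and> (\<forall>k. Cx_closure 6 U (\<lambda>x t. V x t $ k))
   \<and> (\<exists>Vt. (\<forall>x\<in>closure U. \<forall>t\<ge>0. (V x has_vector_derivative Vt x t) (at t within {0..}))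
          \<and> (\<forall>k. Cx_closure 3 U (\<lambda>x t. Vt x t $ k)))
   \<and> bdd_above {norm (V x t) + norm (Vgrad V x t) | x t. x \<in> U \<and> t > 0}
   \<and> bdd_above {\<bar>g x t\<bar> | x t. x \<in> frontier U \<and> t \<ge> 0}
   \<and> continuous_on (closure U \<times> {0..}) (\<lambda>(x,t). \<sigma> x t)
   \<and> C21 U \<sigma>
   \<and> (\<forall>x\<in>U. \<forall>t>0. deriv (\<sigma> x) t =
        divg (\<lambda>y. Amat F1 F2 g1 g2 c1 c2 Shat y *v
                    (grad (\<lambda>z. \<sigma> z t) y - \<sigma> y t *\<^sub>R bvec F1 F2 g1 g2 c1 c2 Shat y)
                  + Amat F1 F2 g1 g2 c1 c2 Shat y *v cvec F1 g1 c1 Shat V y t) x)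
   \<and> (\<forall>x\<in>frontier U. \<forall>t>0. \<sigma> x t = g x t)
   \<and> (\<forall>x\<in>U. \<sigma> x 0 = \<sigma>0 x)
   \<longrightarrow>
     (\<forall>t>0. Sup ((\<lambda>x. \<bar>\<sigma> x t\<bar>) ` U) \<le>
        C * (exp (- eta1 (real CARD('n)) r0 R g1 g2 c1 c2 F1 F2 sl sh * t) * Sup ((\<lambda>x. \<bar>\<sigma>0 x\<bar>) ` U)
             + (Sup {norm (V x t) + norm (Vgrad V x t) | x t. x \<in> U \<and> t > 0}
                + Sup {\<bar>g x t\<bar> | x t. x \<in> frontier U \<and> t \<ge> 0})))
   \<and> Limsup at_top (\<lambda>t. ereal (Sup ((\<lambda>x. \<bar>\<sigma> x t\<bar>) ` U)))
       \<le> ereal C * Limsup at_top (\<lambda>t. ereal (Sup ((\<lambda>x. norm (V x t) + norm (Vgrad V x t)) ` U)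
                                             + Sup ((\<lambda>x. \<bar>g x t\<bar>) ` frontier U)))"
proof -
  define n where "n = real CARD('n)"
  have n: "2 \<le> n" using n2 by (simp add: n_def)
  obtain \<gamma>1 where g1_pos: "0 < g1 0" and \<gamma>1_0: "\<gamma>1 0 = 0" and \<gamma>1_nn: "\<And>z. 0 \<le> z \<Longrightarrow> 0 \<le> \<gamma>1 z"
    and g1_mono: "\<And>z w. 0 \<le> z \<Longrightarrow> z \<le> w \<Longrightarrow> g1 z \<le> g1 w" and \<gamma>1_mono: "\<And>z w. 0 \<le> z \<Longrightarrow> z \<le> w \<Longrightarrow> \<gamma>1 z \<le> \<gamma>1 w"
    and \<gamma>1_deriv: "\<And>z. 0 < z \<Longrightarrow> deriv g1 z * z = \<gamma>1 z"
    and C1_g1: "\<And>S f. C1_on S f \<Longrightarrow> (\<And>x. x \<in> S \<Longrightarrow> 0 < f x) \<Longrightarrow> C1_on S (\<lambda>x. g1 (f x))"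
    and C1_\<gamma>1: "\<And>S f. C1_on S f \<Longrightarrow> (\<And>x. x \<in> S \<Longrightarrow> 0 < f x) \<Longrightarrow> C1_on S (\<lambda>x. \<gamma>1 (f x))"
    using admissible_gE[OF g1] by blast
  obtain \<gamma>2 where g2_pos: "0 < g2 0" and \<gamma>2_0: "\<gamma>2 0 = 0" and \<gamma>2_nn: "\<And>z. 0 \<le> z \<Longrightarrow> 0 \<le> \<gamma>2 z"
    and g2_mono: "\<And>z w. 0 \<le> z \<Longrightarrow> z \<le> w \<Longrightarrow> g2 z \<le> g2 w" and \<gamma>2_mono: "\<And>z w. 0 \<le> z \<Longrightarrow> z \<le> w \<Longrightarrow> \<gamma>2 z \<le> \<gamma>2 w"
    and \<gamma>2_deriv: "\<And>z. 0 < z \<Longrightarrow> deriv g2 z * z = \<gamma>2 z"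
    and C1_g2: "\<And>S f. C1_on S f \<Longrightarrow> (\<And>x. x \<in> S \<Longrightarrow> 0 < f x) \<Longrightarrow> C1_on S (\<lambda>x. g2 (f x))"
    and C1_\<gamma>2: "\<And>S f. C1_on S f \<Longrightarrow> (\<And>x. x \<in> S \<Longrightarrow> 0 < f x) \<Longrightarrow> C1_on S (\<lambda>x. \<gamma>2 (f x))"
    using admissible_gE[OF g2] by blast
  define z where "z c r = \<bar>c\<bar> * r powr (1 - n)" for c r :: real
  have z_nn: "0 \<le> z c r" for c r by (simp add: z_def)
  \<comment> \<open>\<open>z c r\<close> is the length of the steady velocity at radius r. It
    decreases with r, which is why the constants of \<open>eta1\<close> are evaluated at
    \<open>r0\<close>.\<close>
  have z_mono: "z c r \<le> z c r0" if "r \<in> {r0..R}" for c r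
    unfolding z_def using that r0 n by (intro mult_left_mono powr_mono2') auto
  have C1_pow: "C1_on {r0..R} (\<lambda>r. c * r powr (1 - n))" for c
    using r0 by (intro C1_on_mult C1_on_const C1_on_powr C1_on_ident) auto
  \<comment> \<open>For c = 0 the argument is constantly 0, where real powers need not be
    differentiable; the composition is then constant.\<close>
  have C1_z: "C1_on {r0..R} (\<lambda>r. \<phi> (z c r))"
    if "\<And>S f. C1_on S f \<Longrightarrow> (\<And>x. x \<in> S \<Longrightarrow> 0 < f x) \<Longrightarrow> C1_on S (\<lambda>x. \<phi> (f x))" for \<phi> c
  proof (cases "c = 0")
    case True
    then show ?thesis by (simp add: z_def C1_on_const)
  next
    case False
    then show ?thesis unfolding z_def using r0 by (intro that C1_pow) auto
  qed
  have S: "Shat r \<in> {sl..sh}" "Shat r \<in> {0<..<1}" if "r \<in> {r0..R}" for r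
    using sbounds(3)[rule_format, OF that] sbounds(1,2) by auto
  have F_pos: "0 < F1 s" "0 < F2 s" if "s \<in> {0<..<1}" for s
    using positive_of_zero_at_endpoint[OF f1c f2c f0 fmono that] pc(2) that by (auto simp: F1_def F2_def Fq_def)
  have F_pos_all: "\<forall>s\<in>{0<..<1}. 0 < F1 s" "\<forall>s\<in>{0<..<1}. 0 < F2 s"
    using F_pos by auto
  note F1b = C1_range_bounds[OF E1F(1) one_le_numeral F_pos_all(1) sbounds(1,2)]
    and F2b = C1_range_bounds[OF E1F(2) one_le_numeral F_pos_all(2) sbounds(1,2)]
  \<comment> \<open>The right-hand side of the ODE is continuous in r once \<open>Shat\<close> is,
    and it serves as the continuous derivative.\<close>
  have C1_S: "C1_on {r0..R} Shat"
  proof (rule C1_onI)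
    have contS: "continuous_on {r0..R} Shat" by (rule DERIV_continuous_on[OF bspec[OF ode]])
    have cF: "continuous_on {r0..R} (\<lambda>r. F (Shat r))" if "Ck_on 7 {0<..<1} F" for F
    proof (rule continuous_on_compose2[OF _ contS])
      have "continuous_on {0<..<1} ((deriv ^^ 0) F)" using that unfolding Ck_on_def by blast
      then show "continuous_on {0<..<1} F" by simp
    qed (use S in auto)
    have gs: "Gs g (c * r powr (1 - real CARD('n))) = g (z c r) * (c * r powr (1 - n))" for g c r
      by (simp add: Gs_def z_def n_def abs_mult)
    show "continuous_on {r0..R} (\<lambda>r. Gs g2 (c2 * r powr (1 - real CARD('n))) * F2 (Shat r)
                  - Gs g1 (c1 * r powr (1 - real CARD('n))) * F1 (Shat r))"
      unfolding gs
      by (intro continuous_on_diff continuous_on_mult cF E1F C1_on_imp_continuous_on[OF C1_z[OF C1_g1]]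
          C1_on_imp_continuous_on[OF C1_z[OF C1_g2]] C1_on_imp_continuous_on[OF C1_pow])
  qed (use ode in auto)
  have C1_F: "C1_on {r0..R} (\<lambda>r. F (Shat r))" "C1_on {r0..R} (\<lambda>r. deriv F (Shat r))" if "Ck_on 7 {0<..<1} F" for F
    using C1_on_Ck_compose[OF that _ C1_S, of 0] C1_on_Ck_compose[OF that _ C1_S, of 1] S by auto
  \<comment> \<open>Each Jacobian has eigenvalue g on tangential vectors and g +
    \<open>\<gamma>\<close> in the radial direction; \<open>bt\<close> and \<open>bn\<close> are the
    corresponding eigenvalues of B.\<close>
  define bt where "bt r = F1 (Shat r) * g1 (z c1 r) + F2 (Shat r) * g2 (z c2 r)" for r
  define bn where "bn r = F1 (Shat r) * (g1 (z c1 r) + \<gamma>1 (z c1 r)) + F2 (Shat r) * (g2 (z c2 r) + \<gamma>2 (z c2 r))" for r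
  define br where "br r = deriv F2 (Shat r) * (g2 (z c2 r) * (c2 * r powr (1 - n)))
      - deriv F1 (Shat r) * (g1 (z c1 r) * (c1 * r powr (1 - n)))" for r
  \<comment> \<open>\<open>k1\<close> is the tangential eigenvalue of A F1 G1', and
    \<open>k2\<close> is the radial eigenvalue minus the tangential one, divided by r^2.\<close>
  define k1 where "k1 r = F1 (Shat r) * g1 (z c1 r) / bt r" for r
  define k2 where "k2 r = (F1 (Shat r) * (g1 (z c1 r) + \<gamma>1 (z c1 r)) / bn r - F1 (Shat r) * g1 (z c1 r) / bt r) / (r * r)" for r
  define d4 where "d4 = g1 (z c1 r0) + g2 (z c2 r0) +
    ((if c1 = 0 then 0 else deriv g1 (z c1 r0) * z c1 r0) + (if c2 = 0 then 0 else deriv g2 (z c2 r0) * z c2 r0))"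
  define C0 where "C0 = d4 * (Sup (F1 ` {sl..sh}) + Sup (F2 ` {sl..sh}))"
  define C1 where "C1 = min (g1 0) (g2 0) * (Inf (F1 ` {sl..sh}) + Inf (F2 ` {sl..sh}))"
  define C2 where "C2 = (g1 (z c1 r0) * z c1 r0 + g2 (z c2 r0) * z c2 r0)
     * (Sup ((\<lambda>s. \<bar>deriv F1 s\<bar>) ` {sl..sh}) + Sup ((\<lambda>s. \<bar>deriv F2 s\<bar>) ` {sl..sh}))"
  have z_pos: "0 < z c r0" if "c \<noteq> 0" for c using that r0 by (simp add: z_def)
  \<comment> \<open>The convention that terms with c_i = 0 are read as 0 agrees with the value of
    \<open>\<gamma>1\<close> and \<open>\<gamma>2\<close> at 0, so no case distinction
    survives.\<close>
  have "(if c1 = 0 then 0 else deriv g1 (z c1 r0) * z c1 r0) = \<gamma>1 (z c1 r0)"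
    "(if c2 = 0 then 0 else deriv g2 (z c2 r0) * z c2 r0) = \<gamma>2 (z c2 r0)"
    using \<gamma>1_deriv[OF z_pos] \<gamma>2_deriv[OF z_pos] \<gamma>1_0 \<gamma>2_0 by (auto simp: z_def)
  then have d4: "d4 = (g1 (z c1 r0) + \<gamma>1 (z c1 r0)) + (g2 (z c2 r0) + \<gamma>2 (z c2 r0))" by (simp add: d4_def)
  have g_ge: "g1 0 \<le> g1 (z c r)" "g2 0 \<le> g2 (z c r)" for c r
    using g1_mono[OF order_refl z_nn] g2_mono[OF order_refl z_nn] by auto
  have g_pos: "0 < g1 (z c r)" "0 < g2 (z c r)" for c r
    using g_ge[of c r] g1_pos g2_pos by linarith+
  have R0: "r0 \<in> {r0..R}" using R by simp
  \<comment> \<open>The constants \<open>C0\<close> and \<open>C2\<close> are products of sums;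
    compared with a sum of products they contain nonnegative cross terms.\<close>
  have two_products: "a * b + a' * b' \<le> (b + b') * (A + A')"
    if "0 \<le> a" "a \<le> A" "0 \<le> a'" "a' \<le> A'" "0 \<le> b" "0 \<le> b'" for a b a' b' A A' :: real
  proof -
    have "a * b \<le> A * b" "a' * b' \<le> A' * b'" "0 \<le> A' * b" "0 \<le> A * b'"
      using that by (auto intro!: mult_right_mono mult_nonneg_nonneg)
    then show ?thesis by (simp add: algebra_simps)
  qed
  have bn_pos: "0 < bn r" and bt_pos: "0 < bt r" if r: "r \<in> {r0..R}" for r
  proof -
    note F_pos' = F_pos[OF S(2)[OF r]]
    show "0 < bn r" unfolding bn_def
      by (rule add_pos_pos; rule mult_pos_pos; rule F_pos' add_pos_nonneg; rule g_pos \<gamma>1_nn[OF z_nn] \<gamma>2_nn[OF z_nn])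
    show "0 < bt r" unfolding bt_def by (intro add_pos_pos mult_pos_pos F_pos' g_pos)
  qed
  have bn_le: "bn r \<le> C0" if r: "r \<in> {r0..R}" for r
  proof -
    have "bn r \<le> F1 (Shat r) * (g1 (z c1 r0) + \<gamma>1 (z c1 r0)) + F2 (Shat r) * (g2 (z c2 r0) + \<gamma>2 (z c2 r0))"
      unfolding bn_def using F_pos[OF S(2)[OF r]] z_mono[OF r]
      by (intro add_mono mult_left_mono g1_mono g2_mono \<gamma>1_mono \<gamma>2_mono z_nn) auto
    also have "\<dots> \<le> C0"
      unfolding C0_def d4 using F_pos[OF S(2)[OF r]] F1b(1)[OF S(1)[OF r]] F2b(1)[OF S(1)[OF r]]
        g_pos[of _ r0] \<gamma>1_nn[OF z_nn] \<gamma>2_nn[OF z_nn]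
      by (intro two_products add_nonneg_nonneg) (auto intro: less_imp_le)
    finally show ?thesis .
  qed
  have br_le: "\<bar>br r\<bar> \<le> C2" if r: "r \<in> {r0..R}" for r
  proof -
    have zz: "\<bar>c * r powr (1 - n)\<bar> = z c r" for c by (simp add: z_def abs_mult)
    have "\<bar>br r\<bar> \<le> \<bar>deriv F2 (Shat r) * (g2 (z c2 r) * (c2 * r powr (1 - n)))\<bar> + \<bar>deriv F1 (Shat r) * (g1 (z c1 r) * (c1 * r powr (1 - n)))\<bar>"
      unfolding br_def by (rule abs_triangle_ineq4)
    also have "\<dots> = \<bar>deriv F1 (Shat r)\<bar> * (g1 (z c1 r) * z c1 r) + \<bar>deriv F2 (Shat r)\<bar> * (g2 (z c2 r) * z c2 r)"
      using g_pos[of _ r] by (simp add: abs_mult[of "deriv _ _"] abs_mult[of "g1 _"] abs_mult[of "g2 _"] zz less_imp_le)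
    also have "\<dots> \<le> \<bar>deriv F1 (Shat r)\<bar> * (g1 (z c1 r0) * z c1 r0) + \<bar>deriv F2 (Shat r)\<bar> * (g2 (z c2 r0) * z c2 r0)"
      using z_mono[OF r] g_pos[of _ r0]
      by (intro add_mono mult_left_mono mult_mono g1_mono g2_mono z_nn) (auto intro: less_imp_le)
    also have "\<dots> \<le> C2"
      unfolding C2_def using F1b(4)[OF S(1)[OF r]] F2b(4)[OF S(1)[OF r]] g_pos[of _ r0]
      by (intro two_products mult_nonneg_nonneg z_nn) (auto intro: less_imp_le)
    finally show ?thesis .
  qed
  have C1_all: "C1_on {r0..R} bn" "C1_on {r0..R} bt" "C1_on {r0..R} br"
    unfolding bn_def[abs_def] bt_def[abs_def] br_def[abs_def]
    by (intro C1_on_add C1_on_diff C1_on_mult C1_F E1F C1_z C1_g1 C1_g2 C1_\<gamma>1 C1_\<gamma>2 C1_pow; assumption)+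
  have C1_k: "C1_on {r0..R} k1" "C1_on {r0..R} k2"
    unfolding k1_def[abs_def] k2_def[abs_def]
    using bn_pos bt_pos r0
    by (intro C1_on_add C1_on_diff C1_on_divide C1_on_mult C1_on_ident C1_F E1F C1_z C1_g1 C1_\<gamma>1 C1_all; force)+
  note U_nonempty = U(3)
  interpret radial_diffusion U n r0 R C0 C2 bn bt br k1 k2
    by unfold_locales (use n_def r0 R U(1,4) C1_all C1_k bn_pos bt_pos bn_le br_le in auto)
  let ?eta = "eta1 (real CARD('n)) r0 R g1 g2 c1 c2 F1 F2 sl sh"
  have eta: "?eta \<le> rate"
  proof -
    have C1_pos: "0 < C1"
      unfolding C1_def using g1_pos g2_pos F1b(3)[OF S(1)[OF R0]] F2b(3)[OF S(1)[OF R0]]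
      by (intro mult_pos_pos) auto
    \<comment> \<open>Infima and suprema are compared through the values at \<open>Shat r0\<close>,
      a point of the interval.\<close>
    have "C1 \<le> C0"
      unfolding C1_def C0_def
    proof (rule mult_mono)
      show "min (g1 0) (g2 0) \<le> d4"
        unfolding d4 using g_ge(1)[of c1 r0] g_pos(2)[of c2 r0] \<gamma>1_nn[OF z_nn, of c1 r0] \<gamma>2_nn[OF z_nn, of c2 r0] by linarith
      then show "0 \<le> d4" using g1_pos g2_pos by linarith
      show "Inf (F1 ` {sl..sh}) + Inf (F2 ` {sl..sh}) \<le> Sup (F1 ` {sl..sh}) + Sup (F2 ` {sl..sh})"
        using F1b(1,2)[OF S(1)[OF R0]] F2b(1,2)[OF S(1)[OF R0]] by linarith
      show "0 \<le> Inf (F1 ` {sl..sh}) + Inf (F2 ` {sl..sh})"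
        using F1b(3)[OF S(1)[OF R0]] F2b(3)[OF S(1)[OF R0]] by linarith
    qed
    from decay_rate_comparison[OF n r0 R C1_pos this order_trans[OF abs_ge_zero br_le[OF R0]]]
    show ?thesis
      unfolding eta1_def Let_def n_def[symmetric] z_def[symmetric] d4_def[symmetric]
      unfolding C0_def[symmetric] C1_def[symmetric] C2_def[symmetric] rate_def k_def .
  qed
  have Am_eq: "Amat F1 F2 g1 g2 c1 c2 Shat y = Am y"
    and bv_eq: "bvec F1 F2 g1 g2 c1 c2 Shat y = bv y"
    and Km_eq: "Amat F1 F2 g1 g2 c1 c2 Shat y *v cvec F1 g1 c1 Shat V y t = Km y *v V y t"
    if y: "y \<in> U" for y :: "real^'n" and V t
  proof -
    let ?r = "norm y"
    have y0: "y \<noteq> 0" "?r > 0" and r: "?r \<in> {r0..R}" using norm_U'[OF y] by auto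
    have J1: "Gjac g1 (ustar c1 y) = rmat (g1 (z c1 ?r)) (\<gamma>1 (z c1 ?r) / ?r\<^sup>2) y"
      unfolding z_def n_def by (rule Gjac_ustar[where \<gamma> = \<gamma>1, OF y0(1) \<gamma>1_0]) (rule \<gamma>1_deriv)
    have J2: "Gjac g2 (ustar c2 y) = rmat (g2 (z c2 ?r)) (\<gamma>2 (z c2 ?r) / ?r\<^sup>2) y"
      unfolding z_def n_def by (rule Gjac_ustar[where \<gamma> = \<gamma>2, OF y0(1) \<gamma>2_0]) (rule \<gamma>2_deriv)
    have "Bmat F1 F2 g1 g2 c1 c2 Shat y = rmat (bt ?r) ((bn ?r - bt ?r) / ?r\<^sup>2) y"
      unfolding Bmat_def J1 J2 rmat_scale rmat_add bt_def bn_def by (simp add: distrib_left add_divide_distrib)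
    then show A: "Amat F1 F2 g1 g2 c1 c2 Shat y = Am y"
      unfolding Amat_def Am_def using bn_pos[OF r] bt_pos[OF r] y0 by (simp add: rmat_inverse)
    have G: "Gvec g (ustar c y) = (g (z c ?r) * (c * ?r powr (1 - n)) / ?r) *\<^sub>R y" for g c
      unfolding Gvec_def norm_ustar[OF y0(1)] unfolding ustar_eq[OF y0(1)] n_def[symmetric] z_def by simp
    show "bvec F1 F2 g1 g2 c1 c2 Shat y = bv y"
      unfolding bvec_def bv_def G br_def scaleR_scaleR scaleR_diff_left[symmetric] by (simp add: diff_divide_distrib)
    have "Am y ** (F1 (Shat ?r) *\<^sub>R Gjac g1 (ustar c1 y)) = Km y"
      unfolding Am_def Km_def J1 rmat_scale rmat_mult k1_def k2_def
      using bn_pos[OF r] bt_pos[OF r] y0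
      by (intro arg_cong2[of _ _ _ _ "\<lambda>a b. rmat a b y"]) (simp_all add: field_simps power2_eq_square)
    then show "Amat F1 F2 g1 g2 c1 c2 Shat y *v cvec F1 g1 c1 Shat V y t = Km y *v V y t"
      unfolding A cvec_def scaleR_matrix_vector_assoc matrix_vector_mul_assoc by simp
  qed
  have sol: "solution \<sigma> V 0"
    if cont: "continuous_on (closure U \<times> {0..}) (\<lambda>(x,t). \<sigma> x t)" and C21: "C21 U \<sigma>"
      and V: "\<forall>k. Cx_closure 6 U (\<lambda>x t. V x t $ k)"
      and pde: "\<forall>x\<in>U. \<forall>t>0. deriv (\<sigma> x) t =
        divg (\<lambda>y. Amat F1 F2 g1 g2 c1 c2 Shat y *v
                    (grad (\<lambda>z. \<sigma> z t) y - \<sigma> y t *\<^sub>R bvec F1 F2 g1 g2 c1 c2 Shat y)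
                  + Amat F1 F2 g1 g2 c1 c2 Shat y *v cvec F1 g1 c1 Shat V y t) x"
    for \<sigma> :: "real^'n \<Rightarrow> real \<Rightarrow> real" and V :: "real^'n \<Rightarrow> real \<Rightarrow> real^'n"
    unfolding solution_def
  proof (intro conjI cont C21 ballI allI impI order_refl)
    fix x t assume x: "x \<in> U" and t: "0 < (t::real)"
    have V0: "\<forall>is. length is < 6 \<longrightarrow> (\<forall>i. \<forall>x\<in>U. \<forall>t\<ge>0. has_pd i (ipd is (\<lambda>y. V y t $ k)) x)" for k
      using V unfolding Cx_closure_def by blast
    show "has_pd i (\<lambda>y. V y t $ j) x" for i j
      using V0[rule_format, of "[]" x t i j] x t by simp
    \<comment> \<open>The identification of the coefficients holds on \<open>U\<close> only, which
      is enough because a divergence at \<open>x\<close> depends on values near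
      \<open>x\<close>.\<close>
    show "deriv (\<sigma> x) t = divg (\<lambda>y. Am y *v (grad (\<lambda>z. \<sigma> z t) y - \<sigma> y t *\<^sub>R bv y) + Km y *v V y t) x"
      unfolding pde[rule_format, OF x t]
      by (rule divg_cong_open[OF U(1) x]) (simp only: Km_eq, simp only: Am_eq bv_eq)
  qed
  show ?thesis
    by (rule ex_pos_all_weaken[OF stability[OF U_nonempty eta]], elim conjE, intro conjI sol; assumption)
qed

end
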